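(* Let $\Psi\in\overline{\mathcal N}$ with Wiener-Hopf factorization $\Psi(z)=-\phi_+(-z)\phi_-(z)$, $z\in i\mathbb R$. Then the mapping $M_\Psi$ defined by $$M_\Psi(z)=\frac{\Gamma(z)}{W_{\phi_+}(z)}\,W_{\phi_-}(1-z)$$ satisfies the recurrence relation $$M_\Psi(z+1)=\frac{-z}{\Psi(-z)}M_\Psi(z)$$ at least on $i\mathbb R\setminus(\mathcal Z_0(\Psi)\cup\{0\})$, where $\mathcal Z_0(\Psi)=\{z\in i\mathbb R:\Psi(-z)=0\}$. Put $\mathfrak a_\Psi=\mathfrak a_+\mathbb I_{\{\overline{\mathfrak a}_+=0\}}\le 0$ (so $\mathfrak a_\Psi=0$ if $\overline{\mathfrak a}_+<0$). Then: (i) $M_\Psi\in\mathtt A_{(\mathfrak a_\Psi,\,1-\overline{\mathfrak a}_-)}$. (ii) If $\mathfrak a_\Psi=0$, then $M_\Psi$ extends continuously to $i\mathbb R\setminus\{0\}$ provided additionally $\phi_+'(0^+)=\infty$ or $\overline{\mathfrak a}_+<0$; otherwise $M_\Psi\in\mathtt A_{[0,\,1-\overline{\mathfrak a}_-)}$. (iii) In any case $M_\Psi\in\mathtt M_{(\mathfrak a_+,\,1-\mathfrak a_-)}$. (iv) Let $\mathfrak a_+\le\overline{\mathfrak a}_+<0$. If $\mathfrak u_+=-\infty$ or $-\mathfrak u_+\notin\mathbb N$, then on $\mathbb C_{(\mathfrak a_+,1-\overline{\mathfrak a}_-)}$ the function $M_\Psi$ has simple poles at all points $-n$, $n\in\mathbb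 N$, such that $-n>\mathfrak a_+$. Otherwise, if $-\mathfrak u_+\in\mathbb N$, then on $\mathbb C_{(\mathfrak a_+,1-\overline{\mathfrak a}_-)}$ the function $M_\Psi$ has simple poles at all points $-n$ such that $n\in\mathbb N\setminus\{|\mathfrak u_+|,|\mathfrak u_+|+1,\dots\}$. In both cases the residue at each simple pole $-n$ equals $\phi_+(0)\frac{\prod_{k=1}^n\Psi(k)}{n!}$, with the convention $\prod_{k=1}^0=1$. (v) Up to a multiplicative constant, $M_\Psi$ does not depend on the choice of the Wiener-Hopf factors, that is, on replacing $\phi_+$ by $c\phi_+$ and $\phi_-$ by $c^{-1}\phi_-$, $c>0$.
   Context: $\mathbb N=\{0,1,2,\dots\}$. For $-\infty\le a<b\le\infty$, $\mathbb C_{(a,b)}=\{z\in\mathbb C:a<\Re z<b\}$ and $\mathbb C_a=\{z:\Re z=a\}$. $\mathtt A_{(a,b)}$ (resp. $\mathtt M_{(a,b)}$) is the set of holomorphic (resp. meromorphic) functions on $\mathbb C_{(a,b)}$; $\mathtt A_{[a,b)}$ is the set of functions in $\mathtt A_{(a,b)}$ which extend continuously to $\mathbb C_a$. Functions are identified with their analytic/meromorphic extensions. $\overline{\mathcal N}$ is the set of functions $\Psi:i\mathbb R\to\mathbb C$ of the form $\Psi(z)=\frac{\sigma^2}{2}z^2+\gamma z+\int_{-\infty}^\infty(e^{zr}-1-zr\mathbb I_{\{|r|<1\}})\Pi(dr)+\Psi(0)$ with $\Psi(0)\le0$, $\sigma^2\ge0$, $\gamma\in\mathbb R$ and $\Pi$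 a sigma-finite measure on $\mathbb R\setminus\{0\}$ with $\int(1\wedge r^2)\Pi(dr)<\infty$. Bernstein functions: $\mathcal B$ is the set of $\phi\not\equiv0$ of the form $\phi(z)=\phi(0)+\mathtt d z+\int_0^\infty(1-e^{-zy})\mu(dy)$, $\Re z\ge0$, with $\phi(0)\ge0$, $\mathtt d\ge0$ and $\mu$ a sigma-finite measure on $(0,\infty)$ with $\int_0^\infty(1\wedge y)\mu(dy)<\infty$. For $\phi\in\mathcal B$, $\mathfrak a_\phi=\inf\{u<0:\phi\in\mathtt A_{(u,\infty)}\}\in[-\infty,0]$, $\mathfrak u_\phi=\sup\{u\in[\mathfrak a_\phi,0]:\phi(u)=0\}\in[-\infty,0]$, $\overline{\mathfrak a}_\phi=\max\{\mathfrak a_\phi,\mathfrak u_\phi\}$, with $\inf\emptyset=0$, $\sup\emptyset=-\infty$. Wiener-Hopf factorization: every $\Psi\in\overline{\mathcal N}$ ($\Psi\not\equiv0$) can be written $\Psi(z)=-\phi_+(-z)\phi_-(z)$, $z\in i\mathbb R$, with $\phi_\pm\in\mathcal B$, unique up to $(\phi_+,\phi_-)\mapsto(c\phi_+,c^{-1}\phi_-)$, $c>0$. Write $\mathfrak a_\pm,\mathfrak u_\pm,\overline{\mathfrak a}_\pm$ for $\mathfrak a_{\phi_\pm},\mathfrak u_{\phi_\pm},\overline{\mathfrak a}_{\phi_\pm}$. Off the imaginary axis $\Psi$ is given by $-\phi_+(-z)\phi_-(z)$ wherever this is defined. Bernstein-gamma function: for $\phi\in\mathcal B$ and $\Re z>0$,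 $W_\phi(z)=\frac{e^{-\gamma_\phi z}}{\phi(z)}\prod_{k=1}^\infty\frac{\phi(k)}{\phi(k+z)}e^{\frac{\phi'(k)}{\phi(k)}z}$ with $\gamma_\phi=\lim_{n\to\infty}\big(\sum_{k=1}^n\frac{\phi'(k)}{\phi(k)}-\ln\phi(n)\big)$; it satisfies $W_\phi(1)=1$, $W_\phi(z+1)=\phi(z)W_\phi(z)$, and this recurrence extends it meromorphically to $\mathbb C_{(\mathfrak a_\phi,\infty)}$.
   Formalization: In (ii), the "otherwise" claim M_Ψ ∈ A_[0,1−ā_−) is made only when φ_+(0)=0; if φ_+(0)≠0, M_Ψ(z) ~ φ_+(0)/z at 0, so that claim fails and only the continuous extension to iR∖{0} is asserted. *)

theory Defs
  imports "HOL-Complex_Analysis.Complex_Analysis"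
begin

definition vstrip :: "ereal \<Rightarrow> ereal \<Rightarrow> complex set" where
  "vstrip a b = {z. a < ereal (Re z) \<and> ereal (Re z) < b}"

definition vline :: "ereal \<Rightarrow> complex set" where
  "vline a = {z. ereal (Re z) = a}"

abbreviation iR :: "complex set" where
  "iR \<equiv> vline 0"

definition extends_continuously ::
  "(complex \<Rightarrow> complex) \<Rightarrow> complex set \<Rightarrow> complex set \<Rightarrow> bool" where
  "extends_continuously f S T \<longleftrightarrow>
     (\<exists>g. continuous_on (S \<union> T) g \<and> (\<forall>z\<in>S. g z = f z))"

text \<open>The class of functions holomorphic on the open strip between \<open>a\<close> and \<open>b\<close> that extend
  continuously to the left boundary line.\<close>

definition hol_left_closed :: "ereal \<Rightarrow> ereal \<Rightarrow> (complex \<Rightarrow> complex) set" where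
  "hol_left_closed a b =
     {f. f holomorphic_on vstrip a b \<and> extends_continuously f (vstrip a b) (vline a)}"

text \<open>Negative definite functions on the imaginary axis. The values of \<open>\<Psi>\<close> off the axis are
  unconstrained and never used; the number \<open>\<kappa>\<close> is \<open>\<Psi> 0\<close>.\<close>

definition N_bar :: "(complex \<Rightarrow> complex) set" where
  "N_bar = {\<Psi>. \<exists>(\<sigma>2::real) (\<gamma>::real) (\<kappa>::real) (\<nu>::real measure).
      0 \<le> \<sigma>2 \<and> \<kappa> \<le> 0 \<and>
      sigma_finite_measure \<nu> \<and> sets \<nu> = sets (restrict_space borel (- {0})) \<and>
      integrable \<nu> (\<lambda>r. min 1 (r\<^sup>2)) \<and>
      (\<forall>z\<in>iR. \<Psi> z = of_real (\<sigma>2 / 2) * z\<^sup>2 + of_real \<gamma> * z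
         + (\<integral>r. (exp (z * of_real r) - 1 - z * of_real r * indicator {r. \<bar>r\<bar> < 1} r) \<partial>\<nu>)
         + of_real \<kappa>)}"

text \<open>Bernstein functions, as functions on the closed right half-plane; the values elsewhere are
  unconstrained.\<close>

definition bernstein :: "(complex \<Rightarrow> complex) set" where
  "bernstein = {\<phi>. (\<exists>z. 0 \<le> Re z \<and> \<phi> z \<noteq> 0) \<and>
     (\<exists>(q::real) (d::real) (\<mu>::real measure).
        0 \<le> q \<and> 0 \<le> d \<and>
        sigma_finite_measure \<mu> \<and> sets \<mu> = sets (restrict_space borel {0<..}) \<and>
        integrable \<mu> (\<lambda>y. min 1 y) \<and>
        (\<forall>z. 0 \<le> Re z \<longrightarrow>
           \<phi> z = of_real q + of_real d * z + (\<integral>y. (1 - exp (- z * of_real y)) \<partial>\<mu>)))}"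

definition is_hol_extension :: "(complex \<Rightarrow> complex) \<Rightarrow> ereal \<Rightarrow> (complex \<Rightarrow> complex) \<Rightarrow> bool" where
  "is_hol_extension \<phi> u g \<longleftrightarrow>
     g holomorphic_on vstrip u \<infinity> \<and> (\<forall>z. 0 \<le> Re z \<longrightarrow> g z = \<phi> z)"

text \<open>Inserting \<open>0\<close> implements the convention that the infimum over the empty set is \<open>0\<close>.\<close>

definition abscissa :: "(complex \<Rightarrow> complex) \<Rightarrow> ereal" where
  "abscissa \<phi> = Inf (insert 0 {u. u < 0 \<and> (\<exists>g. is_hol_extension \<phi> u g)})"

text \<open>The holomorphic extension of \<open>\<phi>\<close> to \<open>Re z > abscissa \<phi>\<close>, which is unique there; it also
  equals \<open>\<phi>\<close> on the imaginary axis when \<open>abscissa \<phi> = 0\<close>. It is meaningless elsewhere.\<close>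

definition bext :: "(complex \<Rightarrow> complex) \<Rightarrow> complex \<Rightarrow> complex" where
  "bext \<phi> = (SOME g. is_hol_extension \<phi> (abscissa \<phi>) g)"

text \<open>The condition \<open>\<phi>(u) = 0\<close> is read as a limit from the right because \<open>u = abscissa \<phi>\<close> is
  admitted; by monotone convergence this limit is the value at \<open>u\<close> of the integral formula for
  \<open>\<phi>\<close> (possibly minus infinity). The supremum over the empty set is minus infinity in
  \<open>ereal\<close>.\<close>

definition largest_zero :: "(complex \<Rightarrow> complex) \<Rightarrow> ereal" where
  "largest_zero \<phi> =
     Sup {ereal u |u. abscissa \<phi> \<le> ereal u \<and> u \<le> 0 \<and>
                      ((\<lambda>x. bext \<phi> (of_real x)) \<longlongrightarrow> 0) (at_right u)}"

definition abar :: "(complex \<Rightarrow> complex) \<Rightarrow> ereal" where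
  "abar \<phi> = max (abscissa \<phi>) (largest_zero \<phi>)"

definition deriv_at_0_infinite :: "(complex \<Rightarrow> complex) \<Rightarrow> bool" where
  "deriv_at_0_infinite \<phi> \<longleftrightarrow>
     filterlim (\<lambda>x::real. Re (deriv \<phi> (of_real x))) at_top (at_right 0)"

definition wiener_hopf ::
  "(complex \<Rightarrow> complex) \<Rightarrow> (complex \<Rightarrow> complex) \<Rightarrow> (complex \<Rightarrow> complex) \<Rightarrow> bool" where
  "wiener_hopf \<Psi> \<phi>p \<phi>m \<longleftrightarrow>
     \<phi>p \<in> bernstein \<and> \<phi>m \<in> bernstein \<and> (\<forall>z\<in>iR. \<Psi> z = - \<phi>p (- z) * \<phi>m z)"

text \<open>\<open>\<Psi>\<close> off the imaginary axis, expressed through its Wiener-Hopf factors.\<close>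

definition Psi_ext :: "(complex \<Rightarrow> complex) \<Rightarrow> (complex \<Rightarrow> complex) \<Rightarrow> complex \<Rightarrow> complex" where
  "Psi_ext \<phi>p \<phi>m z = - bext \<phi>p (- z) * bext \<phi>m z"

definition gamma_const :: "(complex \<Rightarrow> complex) \<Rightarrow> real" where
  "gamma_const \<phi> =
     lim (\<lambda>n. (\<Sum>k=1..n. Re (deriv \<phi> (of_nat k) / \<phi> (of_nat k))) - ln (Re (\<phi> (of_nat n))))"

definition bg_W_half :: "(complex \<Rightarrow> complex) \<Rightarrow> complex \<Rightarrow> complex" where
  "bg_W_half \<phi> z = exp (- of_real (gamma_const \<phi>) * z) / \<phi> z *
     (\<Prod>k. \<phi> (of_nat (Suc k)) / \<phi> (of_nat (Suc k) + z) *
           exp (deriv \<phi> (of_nat (Suc k)) / \<phi> (of_nat (Suc k)) * z))"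

text \<open>The Bernstein-gamma function. Here \<open>n\<close> is the least natural number with \<open>Re z + n > 0\<close>,
  so that \<open>n = 0\<close> on the right half-plane, and the recurrence is applied \<open>n\<close> times. At a pole
  the value is \<open>0\<close>.\<close>

definition bg_W :: "(complex \<Rightarrow> complex) \<Rightarrow> complex \<Rightarrow> complex" where
  "bg_W \<phi> z = (let n = nat (\<lfloor>- Re z\<rfloor> + 1)
             in bg_W_half \<phi> (z + of_nat n) / (\<Prod>k<n. bext \<phi> (z + of_nat k)))"

text \<open>Inside the strip of meromorphy, removable singularities of the defining formula are removed
  (e.g. where a pole of \<open>Gamma\<close> meets a pole of \<open>bg_W \<phi>p\<close>) and the value at a pole is \<open>0\<close>. On the
  boundary lines \<open>Re z = 0\<close> (if \<open>abscissa \<phi>p = 0\<close>) and \<open>Re z = 1\<close> (if \<open>abscissa \<phi>m = 0\<close>) the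
  formula itself is used, as the function has no meaning on one side of the line.\<close>

definition M_raw :: "(complex \<Rightarrow> complex) \<Rightarrow> (complex \<Rightarrow> complex) \<Rightarrow> complex \<Rightarrow> complex" where
  "M_raw \<phi>p \<phi>m z = Gamma z / bg_W \<phi>p z * bg_W \<phi>m (1 - z)"

definition M_Psi :: "(complex \<Rightarrow> complex) \<Rightarrow> (complex \<Rightarrow> complex) \<Rightarrow> complex \<Rightarrow> complex" where
  "M_Psi \<phi>p \<phi>m z =
     (if z \<in> vstrip (abscissa \<phi>p) (1 - abscissa \<phi>m)
      then remove_sings (M_raw \<phi>p \<phi>m) z else M_raw \<phi>p \<phi>m z)"

definition a_Psi :: "(complex \<Rightarrow> complex) \<Rightarrow> ereal" where
  "a_Psi \<phi>p = (if abar \<phi>p = 0 then abscissa \<phi>p else 0)"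

definition simple_poles_on ::
  "(complex \<Rightarrow> complex) \<Rightarrow> complex set \<Rightarrow> complex set \<Rightarrow> bool" where
  "simple_poles_on f S P \<longleftrightarrow>
     {z\<in>S. is_pole f z} = P \<and> (\<forall>z\<in>P. zorder f z = - 1)"

definition Z0 :: "(complex \<Rightarrow> complex) \<Rightarrow> complex set" where
  "Z0 \<Psi> = {z\<in>iR. \<Psi> (- z) = 0}"

end

theory Submission
  imports Defs
begin

text \<open>Everything rests on how a Bernstein function \<open>\<phi>\<close> continues to the left of the imaginary axis.
  The Taylor coefficients of order two and higher of \<open>\<phi>\<close> at the point \<open>1\<close> are, up to factorials
  and alternating signs, moments of \<open>e\<^sup>-\<^sup>y \<mu>(dy)\<close>. As for power series with
  nonnegative coefficients, holomorphy as far as \<open>Re z > u\<close> therefore forces the exponential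
  moments of \<open>\<mu>\<close> to be finite there (\<open>exp_moment_of_extension\<close>), and the integral formula
  represents \<open>\<phi>\<close> on the whole strip of holomorphy. The formula shows at once that
  \<open>Re \<phi>(z) \<ge> \<phi>(Re z)\<close> and that \<open>\<phi>\<close> is strictly increasing on the real axis inside this strip, unless it is
  constant. So \<open>\<phi>\<close> has at most one real zero, namely \<open>largest_zero \<phi>\<close>, and no zero at all to the right
  of \<open>abar \<phi>\<close>.

  On \<open>Re z > 0\<close> the values of \<open>\<phi>\<close> have positive real part, and \<open>\<bar>\<phi>'/\<phi>\<bar> \<le> 1 / Re z\<close>. Cauchy's
  estimate turns this into a bound of order \<open>(Re z)\<^sup>-\<^sup>2\<close> for the second derivative of \<open>Ln \<phi>\<close>, which is
  what makes the Weierstrass product of the Bernstein-gamma function \<open>W\<close> converge. There \<open>W\<close> is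
  holomorphic and zero-free, and telescoping the product gives \<open>W(1) = 1\<close> and
  \<open>W(z + 1) = \<phi>(z) W(z)\<close>. Unfolding the recurrence \<open>N\<close> times gives
  \<open>1 / W(z) = (\<Prod>k<N. \<phi>(z + k)) / W(z + N)\<close>, so \<open>1 / W\<close> is holomorphic to the right of the
  abscissa, and \<open>W\<close> is holomorphic and zero-free to the right of \<open>abar \<phi>\<close>.

  Consequently \<open>M = \<Gamma>(z) / W\<^sub>+(z) * W\<^sub>-(1 - z)\<close> is \<open>\<Gamma>\<close> times a factor that is holomorphic for
  \<open>abscissa \<phi>p < Re z < 1 - abar \<phi>m\<close>. The only possible poles there are those of \<open>\<Gamma>\<close> at \<open>- n\<close>,
  and the pole at \<open>- n\<close> is cancelled exactly when \<open>\<Prod>k\<le>n. \<phi>p (- k)\<close> vanishes, that is, when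
  \<open>- largest_zero \<phi>p\<close> is one of \<open>0, \<dots>, n\<close> (\<open>Gamma_cofactor_minus_nat_eq_0_iff\<close>). Holomorphy, the
  list of poles and the residues follow from this. On the line \<open>Re z = 0\<close> the factor \<open>\<phi>p\<close> is
  continuous, and when it vanishes at \<open>0\<close> with finite derivative it absorbs the pole of \<open>\<Gamma>\<close> at
  \<open>0\<close>. The dependence on the choice of the factors is explicit because
  \<open>W(z)\<close> becomes \<open>c\<^sup>z\<^sup>-\<^sup>1 W(z)\<close> when \<open>\<phi>\<close> becomes \<open>c \<phi>\<close>.\<close>

section \<open>Bernstein functions and exponential moments\<close>

lemma exp_minus_one_sums:
  fixes w :: "'a::{real_normed_field,banach}"
  shows "(\<lambda>n. w ^ Suc n / fact (Suc n)) sums (exp w - 1)"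
proof -
  have "(\<lambda>n. w ^ n / fact n) sums exp w"
    using exp_converges[of w] by (simp add: scaleR_conv_of_real field_simps)
  then show ?thesis
    by (subst sums_Suc_iff) simp
qed

lemma norm_exp_minus_one_le:
  fixes w :: "'a::{real_normed_field,banach}"
  shows "norm (exp w - 1) \<le> exp (norm w) - 1"
proof -
  have s: "(\<lambda>n. norm (w ^ Suc n / fact (Suc n))) sums (exp (norm w) - 1)"
    using exp_minus_one_sums[of "norm w"]
    by (simp add: norm_divide norm_power norm_mult power_Suc fact_Suc del: of_nat_Suc)
  have "norm (\<Sum>n. w ^ Suc n / fact (Suc n)) \<le> (\<Sum>n. norm (w ^ Suc n / fact (Suc n)))"
    by (rule summable_norm) (use s in \<open>simp only: sums_iff\<close>)
  then show ?thesis
    using s exp_minus_one_sums[of w] by (simp only: sums_iff)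
qed

lemma exp_minus_one_le:
  fixes u :: real
  assumes "0 \<le> u"
  shows "exp u - 1 \<le> u * exp u"
proof -
  have "1 - u \<le> exp (- u)" using exp_ge_add_one_self[of "-u"] by simp
  then have "(1 - u) * exp u \<le> exp (- u) * exp u" by (rule mult_right_mono) simp
  then show ?thesis by (simp add: algebra_simps flip: exp_add)
qed

text \<open>A Bernstein function together with a fixed choice of its characteristics.\<close>

locale bernstein_rep =
  fixes \<phi> :: "complex \<Rightarrow> complex" and q d :: real and \<mu> :: "real measure"
  assumes q_nonneg: "0 \<le> q" and d_nonneg: "0 \<le> d"
    and sets_\<mu>: "sets \<mu> = sets (restrict_space borel {0<..})"
    and integrable_min: "integrable \<mu> (\<lambda>y. min 1 y)"
    and \<phi>_eq: "0 \<le> Re z \<Longrightarrow>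
       \<phi> z = of_real q + of_real d * z + (\<integral>y. (1 - exp (- z * of_real y)) \<partial>\<mu>)"
    and nontrivial: "\<exists>z. 0 \<le> Re z \<and> \<phi> z \<noteq> 0"

lemma bernstein_imp_rep:
  assumes "\<phi> \<in> bernstein"
  obtains q d \<mu> where "bernstein_rep \<phi> q d \<mu>"
  using assms unfolding bernstein_def bernstein_rep_def by blast

context bernstein_rep
begin

lemma space_\<mu>: "space \<mu> = {0<..}"
  using sets_eq_imp_space_eq[OF sets_\<mu>] by (simp add: space_restrict_space)

lemma measurable_\<mu>: "f \<in> borel_measurable borel \<Longrightarrow> f \<in> borel_measurable \<mu>"
  by (subst measurable_cong_sets[OF sets_\<mu> refl]) (rule measurable_restrict_space1)

text \<open>Finiteness of the integral of \<open>e\<^sup>-\<^sup>x\<^sup>y\<close> over \<open>y \<ge> 1\<close>. The factor \<open>min 1 y\<close> makes the behaviour of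
  \<open>\<mu>\<close> near \<open>0\<close> harmless, so that positive and negative \<open>x\<close> can be treated alike.\<close>

definition exp_moment :: "real \<Rightarrow> bool" where
  "exp_moment x \<longleftrightarrow> integrable \<mu> (\<lambda>y. min 1 y * exp (- x * y))"

lemma exp_moment_mono:
  assumes "exp_moment x" "x \<le> x'"
  shows "exp_moment x'"
  unfolding exp_moment_def
proof (rule Bochner_Integration.integrable_bound)
  show "integrable \<mu> (\<lambda>y. min 1 y * exp (- x * y))" using assms by (simp add: exp_moment_def)
  show "AE y in \<mu>. norm (min 1 y * exp (- x' * y)) \<le> norm (min 1 y * exp (- x * y))"
    using assms(2) by (intro AE_I2) (auto simp: space_\<mu> abs_mult intro!: mult_mono mult_right_mono)
qed (intro measurable_\<mu>, measurable)

lemma exp_moment_nonneg: "0 \<le> x \<Longrightarrow> exp_moment x"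
  by (rule exp_moment_mono[of 0]) (use integrable_min in \<open>auto simp: exp_moment_def\<close>)

text \<open>The dominating function used for all integrals below: the summand \<open>min 1 y\<close> covers the bounded
  part of an integrand, the other summand its exponential growth.\<close>

lemma integrable_moment_bound:
  fixes f :: "real \<Rightarrow> 'a::{banach,second_countable_topology}"
  assumes "exp_moment x" "f \<in> borel_measurable borel"
    and "\<And>y. 0 < y \<Longrightarrow> norm (f y) \<le> C * (min 1 y + min 1 y * exp (- x * y))"
  shows "integrable \<mu> f"
proof (rule Bochner_Integration.integrable_bound)
  show "integrable \<mu> (\<lambda>y. C * (min 1 y + min 1 y * exp (- x * y)))"
    using assms(1) integrable_min unfolding exp_moment_def by auto
  show "AE y in \<mu>. norm (f y) \<le> norm (C * (min 1 y + min 1 y * exp (- x * y)))"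
    by (intro AE_I2 order_trans[OF assms(3)]) (auto simp: space_\<mu>)
qed (intro measurable_\<mu> assms)

text \<open>Near \<open>y = 0\<close> the integrand is of order \<open>y\<close>; for \<open>y \<ge> 1\<close> it is at most \<open>1 + e\<^sup>-\<^sup>x\<^sup>y\<close>.\<close>

lemma integrable_one_minus_exp:
  assumes "exp_moment (Re z)"
  shows "integrable \<mu> (\<lambda>y. 1 - exp (- z * of_real y))"
proof (rule integrable_moment_bound[OF assms])
  show "(\<lambda>y. 1 - exp (- z * complex_of_real y)) \<in> borel_measurable borel" by measurable
  fix y :: real assume y: "0 < y"
  let ?C = "1 + norm z * exp (norm z)"
  show "norm (1 - exp (- z * of_real y)) \<le> ?C * (min 1 y + min 1 y * exp (- Re z * y))"
  proof (cases "y \<le> 1")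
    case True
    have "norm (1 - exp (- z * of_real y)) \<le> exp (norm z * y) - 1"
      using norm_exp_minus_one_le[of "- z * of_real y"] y by (simp add: norm_mult norm_minus_commute)
    also have "\<dots> \<le> norm z * y * exp (norm z * y)"
      by (rule exp_minus_one_le) (use y in auto)
    also have "\<dots> \<le> norm z * y * exp (norm z)"
      using True y by (intro mult_left_mono) (auto simp: mult_left_le)
    also have "\<dots> \<le> ?C * y" using y by (simp add: algebra_simps)
    also have "\<dots> \<le> ?C * (min 1 y + min 1 y * exp (- Re z * y))"
      using y True by (intro mult_left_mono) auto
    finally show ?thesis .
  next
    case False
    have "norm (1 - exp (- z * of_real y)) \<le> 1 + exp (- Re z * y)"
      by (rule order_trans[OF norm_triangle_ineq4]) simp
    also have "\<dots> \<le> ?C * (1 + exp (- Re z * y))"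
      using mult_right_mono[of 1 ?C "1 + exp (- Re z * y)"] by (simp add: add_nonneg_nonneg)
    finally show ?thesis using False by simp
  qed
qed

text \<open>The integral formula makes sense beyond the closed right half-plane, wherever the
  exponential moment exists; it is the analytic continuation of the Bernstein function.\<close>

definition B :: "complex \<Rightarrow> complex" where
  "B z = of_real q + of_real d * z + (\<integral>y. (1 - exp (- z * of_real y)) \<partial>\<mu>)"

lemma B_eq: "0 \<le> Re z \<Longrightarrow> B z = \<phi> z"
  by (simp add: B_def \<phi>_eq)

definition moment :: "nat \<Rightarrow> complex \<Rightarrow> complex" where
  "moment n z = (\<integral>y. of_real (y ^ n) * exp (- z * of_real y) \<partial>\<mu>)"

text \<open>This majorant sums the absolute values of all terms but the first in the expansion of \<open>e\<^sup>-\<^sup>z\<^sup>y\<close>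
  around a point at distance \<open>s\<close>; it is the reason why the power series of \<open>B\<close> may be integrated
  term by term.\<close>

lemma exp_gap_integrable:
  assumes "exp_moment (x - s)" "0 \<le> s"
  shows "integrable \<mu> (\<lambda>y. (exp (s * y) - 1) * exp (- x * y))"
proof (rule integrable_moment_bound[OF assms(1)])
  fix y :: real assume y: "0 < y"
  have "exp (s * y) - 1 \<le> (1 + s) * min 1 y * exp (s * y)"
  proof (cases "y \<le> 1")
    case True
    have "exp (s * y) - 1 \<le> s * y * exp (s * y)"
      by (rule exp_minus_one_le) (use y assms in auto)
    also have "\<dots> \<le> (1 + s) * y * exp (s * y)"
      using y by (intro mult_right_mono) auto
    finally show ?thesis using True by simp
  next
    case False
    have "exp (s * y) - 1 \<le> 1 * exp (s * y)" by simp
    also have "\<dots> \<le> (1 + s) * exp (s * y)" by (rule mult_right_mono) (use assms in auto)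
    finally show ?thesis using False by simp
  qed
  then have "(exp (s * y) - 1) * exp (- x * y) \<le> (1 + s) * min 1 y * exp (s * y) * exp (- x * y)"
    by (rule mult_right_mono) simp
  also have "\<dots> = (1 + s) * (min 1 y * exp (- (x - s) * y))"
    by (simp add: algebra_simps flip: exp_add)
  also have "\<dots> \<le> (1 + s) * (min 1 y + min 1 y * exp (- (x - s) * y))"
    using y assms by (intro mult_left_mono) auto
  finally show "norm ((exp (s * y) - 1) * exp (- x * y))
      \<le> (1 + s) * (min 1 y + min 1 y * exp (- (x - s) * y))"
    using y assms by (simp add: abs_mult)
qed measurable

text \<open>A power of \<open>y\<close> is one term of the exponential series, so it costs an arbitrarily small amount of
  exponential decay.\<close>

lemma moment_integrable:
  assumes "exp_moment x0" "x0 < Re z"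
  shows "integrable \<mu> (\<lambda>y. of_real (y ^ Suc n) * exp (- z * of_real y))"
proof (rule Bochner_Integration.integrable_bound)
  let ?s = "Re z - x0"
  show "integrable \<mu> (\<lambda>y. fact (Suc n) / ?s ^ Suc n * ((exp (?s * y) - 1) * exp (- Re z * y)))"
    by (rule integrable_mult_right, rule exp_gap_integrable) (use assms in auto)
  show "AE y in \<mu>. norm (of_real (y ^ Suc n) * exp (- z * of_real y))
       \<le> norm (fact (Suc n) / ?s ^ Suc n * ((exp (?s * y) - 1) * exp (- Re z * y)))"
  proof (rule AE_I2)
    fix y assume "y \<in> space \<mu>"
    then have y: "0 < y" by (simp add: space_\<mu>)
    have "(?s * y) ^ Suc n / fact (Suc n) \<le> exp (?s * y) - 1"
    proof -
      have "(\<Sum>k\<in>{n}. (?s * y) ^ Suc k / fact (Suc k)) \<le> (\<Sum>k. (?s * y) ^ Suc k / fact (Suc k))"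
        using exp_minus_one_sums[of "?s * y"] y assms
        by (intro sum_le_suminf) (auto simp: sums_iff simp del: fact_Suc power_Suc)
      then show ?thesis using exp_minus_one_sums[of "?s * y"] by (simp only: sums_iff) simp
    qed
    then have "y ^ Suc n \<le> fact (Suc n) / ?s ^ Suc n * (exp (?s * y) - 1)"
      using assms by (simp add: pos_divide_le_eq pos_le_divide_eq power_mult_distrib mult.commute
          del: fact_Suc power_Suc)
    then have "y ^ Suc n * exp (- Re z * y)
        \<le> fact (Suc n) / ?s ^ Suc n * (exp (?s * y) - 1) * exp (- Re z * y)"
      by (rule mult_right_mono) simp
    then show "norm (of_real (y ^ Suc n) * exp (- z * of_real y))
       \<le> norm (fact (Suc n) / ?s ^ Suc n * ((exp (?s * y) - 1) * exp (- Re z * y)))"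
      using y assms by (simp add: norm_mult norm_power abs_mult del: fact_Suc power_Suc)
  qed
qed (intro measurable_\<mu>, measurable)

definition taylor_coeff :: "complex \<Rightarrow> nat \<Rightarrow> complex" where
  "taylor_coeff z0 n = (case n of 0 \<Rightarrow> B z0
     | Suc k \<Rightarrow> (if k = 0 then of_real d else 0) - (- 1) ^ Suc k / fact (Suc k) * moment (Suc k) z0)"

text \<open>Expand \<open>e\<^sup>-\<^sup>z\<^sup>y\<close> around \<open>z0\<close> and integrate term by term. The expansion converges on the largest disc
  around \<open>z0\<close> that stays to the right of \<open>x0\<close>, which makes \<open>B\<close> holomorphic and yields all its
  derivatives at once.\<close>

lemma B_power_series:
  assumes x0: "exp_moment x0" and z: "norm (z - z0) < Re z0 - x0"
  shows "(\<lambda>n. taylor_coeff z0 n * (z - z0) ^ n) sums B z"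
proof -
  let ?s = "norm (z - z0)"
  \<comment> \<open>The constant term is left out: on its own it need not be integrable near \<open>y = 0\<close>.\<close>
  define f where "f n y = (- (z - z0) * of_real y) ^ Suc n / fact (Suc n) * exp (- z0 * of_real y)"
    for n and y :: real
  have Re_z: "x0 < Re z"
    using abs_Re_le_cmod[of "z - z0"] z by simp
  have pos: "x0 < Re z0" using z norm_ge_zero[of "z - z0"] by linarith
  have f_sums: "(\<lambda>n. f n y) sums (exp (- z * of_real y) - exp (- z0 * of_real y))" for y
  proof -
    have "(\<lambda>n. f n y) sums ((exp (- (z - z0) * of_real y) - 1) * exp (- z0 * of_real y))"
      unfolding f_def by (rule sums_mult2[OF exp_minus_one_sums])
    then show ?thesis by (simp add: algebra_simps flip: exp_add)
  qed
  have f_norm: "(\<lambda>n. norm (f n y)) sums ((exp (?s * y) - 1) * exp (- Re z0 * y))" if "0 < y" for y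
    using sums_mult2[OF exp_minus_one_sums[of "?s * y"], of "exp (- Re z0 * y)"] that
    by (simp add: f_def norm_mult norm_divide norm_power norm_minus_commute abs_mult del: fact_Suc power_Suc)
  have f_eq: "f n y = (- 1) ^ Suc n / fact (Suc n) * (z - z0) ^ Suc n
      * (of_real (y ^ Suc n) * exp (- z0 * of_real y))" for n y
    unfolding f_def mult_minus_left power_minus[of "(z - z0) * of_real y"] power_mult_distrib
    by (simp del: fact_Suc power_Suc)
  have int_f: "integrable \<mu> (f n)" for n
    unfolding f_eq[abs_def] by (rule integrable_mult_right) (rule moment_integrable[OF x0 pos])
  have gap: "integrable \<mu> (\<lambda>y. (exp (?s * y) - 1) * exp (- Re z0 * y))"
    by (rule exp_gap_integrable, rule exp_moment_mono[OF x0]) (use z in auto)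
  have summ: "summable (\<lambda>n. \<integral>y. norm (f n y) \<partial>\<mu>)"
  proof (rule summableI_nonneg_bounded)
    fix N
    have "(\<Sum>n<N. \<integral>y. norm (f n y) \<partial>\<mu>) = (\<integral>y. (\<Sum>n<N. norm (f n y)) \<partial>\<mu>)"
      by (rule Bochner_Integration.integral_sum[symmetric]) (intro integrable_norm int_f)
    also have "\<dots> \<le> (\<integral>y. (exp (?s * y) - 1) * exp (- Re z0 * y) \<partial>\<mu>)"
    proof (rule integral_mono[OF _ gap])
      show "integrable \<mu> (\<lambda>y. \<Sum>n<N. norm (f n y))"
        by (intro Bochner_Integration.integrable_sum integrable_norm int_f)
      fix y assume "y \<in> space \<mu>"
      then have y: "0 < y" by (simp add: space_\<mu>)
      show "(\<Sum>n<N. norm (f n y)) \<le> (exp (?s * y) - 1) * exp (- Re z0 * y)"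
        using f_norm[OF y] sum_le_suminf[of "\<lambda>n. norm (f n y)" "{..<N}"] by (auto simp: sums_iff)
    qed
    finally show "(\<Sum>n<N. \<integral>y. norm (f n y) \<partial>\<mu>) \<le> (\<integral>y. (exp (?s * y) - 1) * exp (- Re z0 * y) \<partial>\<mu>)" .
  qed simp
  have "(\<lambda>n. \<integral>y. f n y \<partial>\<mu>) sums (\<integral>y. (\<Sum>n. f n y) \<partial>\<mu>)"
    by (rule sums_integral[OF int_f _ summ])
       (use f_norm in \<open>auto simp: space_\<mu> sums_iff intro!: AE_I2\<close>)
  also have "(\<integral>y. (\<Sum>n. f n y) \<partial>\<mu>) =
      (\<integral>y. (1 - exp (- z0 * of_real y)) - (1 - exp (- z * of_real y)) \<partial>\<mu>)"
    using f_sums by (simp add: sums_iff)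
  also have "\<dots> = (\<integral>y. (1 - exp (- z0 * of_real y)) \<partial>\<mu>) - (\<integral>y. (1 - exp (- z * of_real y)) \<partial>\<mu>)"
    by (intro Bochner_Integration.integral_diff integrable_one_minus_exp exp_moment_mono[OF x0])
       (use Re_z pos in auto)
  also have "\<dots> = B z0 - B z + of_real d * (z - z0)"
    by (simp add: B_def algebra_simps)
  finally have 1: "(\<lambda>n. \<integral>y. f n y \<partial>\<mu>) sums (B z0 - B z + of_real d * (z - z0))" .
  have 2: "(\<lambda>n. if n = 0 then of_real d * (z - z0) else 0) sums (of_real d * (z - z0))"
    using sums_single[of 0 "\<lambda>_. of_real d * (z - z0)"] by simp
  have int_eq: "(\<integral>y. f n y \<partial>\<mu>) = (- 1) ^ Suc n / fact (Suc n) * (z - z0) ^ Suc n * moment (Suc n) z0" for n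
    unfolding f_eq[abs_def] moment_def by (rule integral_mult_right_zero)
  have "(if n = 0 then of_real d * (z - z0) else 0) - (\<integral>y. f n y \<partial>\<mu>)
      = taylor_coeff z0 (Suc n) * (z - z0) ^ Suc n" for n
  proof (cases "n = 0")
    case True
    then show ?thesis by (simp add: taylor_coeff_def int_eq algebra_simps)
  next
    case False
    then show ?thesis by (simp add: taylor_coeff_def int_eq del: power_Suc fact_Suc)
  qed
  then have "(\<lambda>n. taylor_coeff z0 (Suc n) * (z - z0) ^ Suc n) sums (B z - B z0)"
    using sums_diff[OF 2 1] by (simp del: power_Suc)
  then show ?thesis
    by (subst (asm) sums_Suc_iff) (simp add: taylor_coeff_def)
qed

end

section \<open>Analytic continuation of Bernstein functions\<close>

lemma higher_deriv_power_series:
  fixes f :: "complex \<Rightarrow> complex" and a :: "nat \<Rightarrow> complex"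
  assumes "0 < r" "\<And>w. w \<in> ball z r \<Longrightarrow> (\<lambda>n. a n * (w - z) ^ n) sums f w"
  shows "(deriv ^^ n) f z = fact n * a n"
proof -
  have "eventually (\<lambda>u. (\<lambda>n. fps_nth (Abs_fps a) n * u ^ n) sums f (z + u)) (nhds 0)"
  proof -
    have "eventually (\<lambda>u. u \<in> ball 0 r) (nhds (0::complex))"
      using assms(1) by (intro eventually_nhds_in_open) auto
    then show ?thesis
    proof eventually_elim
      case (elim u)
      then show ?case using assms(2)[of "z + u"] by (simp add: dist_norm)
    qed
  qed
  then have "(\<lambda>u. f (z + u)) has_fps_expansion Abs_fps a"
    by (rule has_fps_expansionI)
  from fps_nth_fps_expansion[OF this, of n] show ?thesis
    by (simp add: higher_deriv_shift_0[of n f z] o_def field_simps)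
qed

lemma open_vstrip: "open (vstrip a b)"
proof -
  have "vstrip a b = (\<lambda>z. ereal (Re z)) -` {a<..<b}"
    by (auto simp: vstrip_def)
  also have "open \<dots>"
    by (intro open_vimage continuous_on_ereal continuous_intros open_greaterThanLessThan)
  finally show ?thesis .
qed

lemma convex_vstrip_infinity: "convex (vstrip a \<infinity>)"
  by (cases a) (auto simp: vstrip_def convex_halfspace_Re_gt)

text \<open>The two extensions agree for \<open>Re z \<ge> 0\<close> by definition, hence everywhere by the identity theorem.\<close>

lemma hol_extension_unique:
  assumes f: "is_hol_extension \<phi> a f" and g: "is_hol_extension \<phi> a g"
    and a: "a \<le> 0" and z: "a < ereal (Re z) \<or> 0 \<le> Re z"
  shows "f z = g z"
proof (cases "0 \<le> Re z")
  case True
  then show ?thesis using f g by (simp add: is_hol_extension_def)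
next
  case False
  then have z: "z \<in> vstrip a \<infinity>" using z by (auto simp: vstrip_def)
  have ext: "f holomorphic_on vstrip a \<infinity>" "g holomorphic_on vstrip a \<infinity>"
    "\<And>w. 0 < Re w \<Longrightarrow> f w = g w"
    using f g by (simp_all add: is_hol_extension_def)
  show ?thesis
  proof (rule analytic_continuation_open[of "{z. 0 < Re z}" "vstrip a \<infinity>" f g])
    show "{z. 0 < Re z} \<noteq> {}" by (auto intro!: exI[of _ 1])
    show "{z. 0 < Re z} \<subseteq> vstrip a \<infinity>"
      using a by (auto simp: vstrip_def zero_ereal_def intro: le_less_trans)
    show "connected (vstrip a \<infinity>)" by (intro convex_connected convex_vstrip_infinity)
  qed (use z ext in \<open>simp_all add: open_vstrip open_halfspace_Re_gt\<close>)
qed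

context bernstein_rep
begin

lemma B_differentiable:
  assumes "exp_moment x" "x < Re z"
  shows "(B has_field_derivative (of_real d + moment 1 z)) (at z)"
proof -
  have s: "(\<lambda>n. taylor_coeff z n * (w - z) ^ n) sums B w" if "w \<in> ball z (Re z - x)" for w
    using that by (intro B_power_series[OF assms(1)]) (simp add: dist_norm norm_minus_commute)
  have "B holomorphic_on ball z (Re z - x)"
    by (rule power_series_holomorphic[OF s])
  then have "(B has_field_derivative deriv B z) (at z)"
    by (rule holomorphic_derivI) (use assms in auto)
  also have "deriv B z = of_real d + moment 1 z"
    using higher_deriv_power_series[OF _ s, of "Re z - x" 1] assms by (simp add: taylor_coeff_def)
  finally show ?thesis .
qed

lemma moment_of_real:
  "moment n (of_real x) = of_real (\<integral>y. y ^ n * exp (- x * y) \<partial>\<mu>)"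
proof -
  have "(\<lambda>y. of_real (y ^ n) * exp (- of_real x * complex_of_real y))
      = (\<lambda>y. complex_of_real (y ^ n * exp (- x * y)))"
    by (simp add: exp_of_real[symmetric])
  then show ?thesis by (simp only: moment_def integral_complex_of_real)
qed

text \<open>Landau's argument for integrals with a positive measure. If \<open>\<phi>\<close> extends holomorphically to
  \<open>Re z > u\<close>, then its Taylor series at \<open>1\<close> converges at \<open>x\<close>. At points to the left of \<open>1\<close> all
  terms from the second-order one on have the same sign, so the convergent sum may be exchanged with
  the integral, and the result is an exponential moment.\<close>

lemma exp_moment_of_extension:
  assumes g: "g holomorphic_on {z. u < Re z}" "\<And>z. 0 < Re z \<Longrightarrow> g z = \<phi> z" and "u < x"
  shows "exp_moment x"
proof (cases "0 \<le> x")
  case True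
  then show ?thesis by (rule exp_moment_nonneg)
next
  case x: False
  define s where "s = 1 - x"
  have s: "1 \<le> s" using x by (simp add: s_def)
  \<comment> \<open>the Taylor series of \<open>g\<close> at \<open>1\<close> reaches \<open>x\<close>, and its coefficients are those of \<open>B\<close>\<close>
  have "g holomorphic_on ball 1 (1 - u)"
  proof (rule holomorphic_on_subset[OF g(1)], safe)
    fix z :: complex assume "z \<in> ball 1 (1 - u)"
    then show "u < Re z" using abs_Re_le_cmod[of "1 - z"] by (simp add: dist_norm)
  qed
  moreover have "of_real x \<in> ball (1::complex) (1 - u)"
    using x assms norm_of_real[of "1 - x", where 'a = complex] by (simp add: dist_norm)
  ultimately have "(\<lambda>n. (deriv ^^ n) g 1 / fact n * (of_real x - 1) ^ n) sums g (of_real x)"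
    by (rule holomorphic_power_series)
  moreover have "(deriv ^^ n) g 1 = fact n * taylor_coeff 1 n" for n
  proof (rule higher_deriv_power_series[of 1])
    fix w :: complex assume w: "w \<in> ball 1 1"
    then have "0 < Re w" using abs_Re_le_cmod[of "1 - w"] by (simp add: dist_norm)
    moreover have "(\<lambda>n. taylor_coeff 1 n * (w - 1) ^ n) sums B w"
      by (rule B_power_series[of 0]) (use w in \<open>auto simp: exp_moment_nonneg dist_norm norm_minus_commute\<close>)
    ultimately show "(\<lambda>n. taylor_coeff 1 n * (w - 1) ^ n) sums g w"
      by (simp add: g B_eq)
  qed simp
  ultimately have "summable (\<lambda>n. taylor_coeff 1 n * (of_real x - 1) ^ n)"
    by (simp add: sums_iff)
  then have sm: "summable (\<lambda>n. taylor_coeff 1 (Suc n) * (of_real x - 1) ^ Suc n)"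
    by (subst summable_Suc_iff)
  \<comment> \<open>nonnegative terms, because \<open>s = 1 - x > 0\<close>\<close>
  define f where "f n y = (s * y) ^ Suc n / fact (Suc n) * exp (- y)" for n and y :: real
  have f_eq: "f n y = s ^ Suc n / fact (Suc n) * (y ^ Suc n * exp (- y))" for n y
    by (simp add: f_def power_mult_distrib del: power_Suc fact_Suc)
  have int_f: "integrable \<mu> (f n)" for n
  proof -
    have "complex_integrable \<mu> (\<lambda>y. of_real (y ^ Suc n) * exp (- 1 * of_real y))"
      by (rule moment_integrable[of 0]) (auto intro: exp_moment_nonneg)
    moreover have "of_real (y ^ Suc n) * exp (- 1 * complex_of_real y) = of_real (y ^ Suc n * exp (- y))" for y
      by (simp add: exp_of_real[symmetric])
    ultimately have "complex_integrable \<mu> (\<lambda>y. of_real (y ^ Suc n * exp (- y)))" by (simp only:)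
    then have "integrable \<mu> (\<lambda>y. y ^ Suc n * exp (- y))"
      by (simp only: complex_of_real_integrable_eq)
    then show ?thesis unfolding f_eq[abs_def] by (rule integrable_mult_right)
  qed
  have "taylor_coeff 1 (Suc n) * (of_real x - 1) ^ Suc n
      = (if n = 0 then of_real d * (of_real x - 1) else 0) - of_real (\<integral>y. f n y \<partial>\<mu>)" for n
  proof -
    have "(\<integral>y. f n y \<partial>\<mu>) = s ^ Suc n / fact (Suc n) * (\<integral>y. y ^ Suc n * exp (- y) \<partial>\<mu>)"
      unfolding f_eq[abs_def] by (rule integral_mult_right_zero)
    moreover have "moment (Suc n) 1 = of_real (\<integral>y. y ^ Suc n * exp (- y) \<partial>\<mu>)"
      using moment_of_real[of "Suc n" 1] by simp
    moreover have "(of_real x - 1) ^ Suc n = (-1) ^ Suc n * (of_real (s ^ Suc n) :: complex)"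
      by (simp add: s_def flip: power_mult_distrib del: power_Suc)
    moreover have "(if n = 0 then of_real d else 0) * (of_real x - 1) ^ Suc n
        = (if n = 0 then of_real d * (complex_of_real x - 1) else 0)"
      by simp
    moreover have "(- 1) ^ Suc n / fact (Suc n) * of_real T * ((-1) ^ Suc n * of_real (s ^ Suc n))
        = complex_of_real (s ^ Suc n / fact (Suc n) * T)" for T
    proof -
      have "(- 1) ^ Suc n / fact (Suc n) * of_real T * ((-1) ^ Suc n * of_real (s ^ Suc n))
          = ((- 1) ^ Suc n * (- 1) ^ Suc n) * complex_of_real (s ^ Suc n / fact (Suc n) * T)"
        by (simp add: mult_ac del: power_Suc fact_Suc)
      then show ?thesis by (simp flip: power_mult_distrib)
    qed
    ultimately show ?thesis
      by (simp only: taylor_coeff_def nat.case left_diff_distrib)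
  qed
  then have "summable (\<lambda>n. (if n = 0 then of_real d * (of_real x - 1) else 0) - complex_of_real (\<integral>y. f n y \<partial>\<mu>))"
    using sm by (simp del: power_Suc)
  moreover have "summable (\<lambda>n. if n = 0 then complex_of_real d * (of_real x - 1) else 0)"
    by (rule summable_finite[of "{0}"]) auto
  ultimately have "summable (\<lambda>n. complex_of_real (\<integral>y. f n y \<partial>\<mu>))"
    using summable_diff by fastforce
  then have "summable (\<lambda>n. \<integral>y. f n y \<partial>\<mu>)"
    by (simp only: summable_of_real_iff)
  moreover have "(\<integral>y. f n y \<partial>\<mu>) = (\<integral>y. norm (f n y) \<partial>\<mu>)" for n
    using s by (intro Bochner_Integration.integral_cong) (auto simp: f_def space_\<mu>)
  ultimately have summ: "summable (\<lambda>n. \<integral>y. norm (f n y) \<partial>\<mu>)" by simp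
  have f_sums: "(\<lambda>n. f n y) sums ((exp (s * y) - 1) * exp (- y))" for y
    unfolding f_def by (rule sums_mult2[OF exp_minus_one_sums])
  have f_norm: "summable (\<lambda>n. norm (f n y))" if "0 < y" for y
    using f_sums[of y] s that by (simp add: sums_iff f_def)
  have "integrable \<mu> (\<lambda>y. \<Sum>n. f n y)"
    by (rule integrable_suminf[OF int_f _ summ]) (use f_norm in \<open>auto simp: space_\<mu>\<close>)
  then have gap: "integrable \<mu> (\<lambda>y. (exp (s * y) - 1) * exp (- y))"
    using f_sums by (simp add: sums_iff)
  show ?thesis unfolding exp_moment_def
  proof (rule Bochner_Integration.integrable_bound)
    show "integrable \<mu> (\<lambda>y. 2 * ((exp (s * y) - 1) * exp (- y)))"
      by (rule integrable_mult_right[OF gap])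
    show "AE y in \<mu>. norm (min 1 y * exp (- x * y)) \<le> norm (2 * ((exp (s * y) - 1) * exp (- y)))"
    proof (rule AE_I2)
      fix y assume "y \<in> space \<mu>"
      then have y: "0 < y" by (simp add: space_\<mu>)
      have "y \<le> s * y" using s y by simp
      also have "\<dots> \<le> exp (s * y) - 1" using exp_ge_add_one_self[of "s * y"] by linarith
      finally have le: "y \<le> exp (s * y) - 1" .
      have "min 1 y * exp (s * y) = min 1 y * (exp (s * y) - 1) + min 1 y" by (simp add: algebra_simps)
      also have "\<dots> \<le> 1 * (exp (s * y) - 1) + (exp (s * y) - 1)"
        using le y s by (intro add_mono mult_right_mono) auto
      finally have "min 1 y * exp (s * y) * exp (- y) \<le> 2 * (exp (s * y) - 1) * exp (- y)"
        by (intro mult_right_mono) auto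
      moreover have "exp (s * y) * exp (- y) = exp (- x * y)"
        by (simp add: s_def algebra_simps flip: exp_add)
      ultimately show "norm (min 1 y * exp (- x * y)) \<le> norm (2 * ((exp (s * y) - 1) * exp (- y)))"
        using y s le by (simp add: abs_mult mult.assoc algebra_simps)
    qed
  qed (intro measurable_\<mu>, measurable)
qed

lemma abscissa_le_0: "abscissa \<phi> \<le> 0"
  by (auto simp: abscissa_def intro: Inf_lower)

lemma exp_moment_above_abscissa:
  assumes "abscissa \<phi> < ereal x"
  shows "exp_moment x"
proof -
  from assms obtain u where u: "u < ereal x" "u = 0 \<or> (u < 0 \<and> (\<exists>g. is_hol_extension \<phi> u g))"
    unfolding abscissa_def Inf_less_iff by blast
  show ?thesis
  proof (cases "u = 0")
    case True
    then show ?thesis using u by (intro exp_moment_nonneg) simp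
  next
    case False
    with u obtain g where g: "is_hol_extension \<phi> u g" by blast
    obtain v where v: "u < ereal v" "v < x" using ereal_dense2[OF u(1)] by auto
    show ?thesis
    proof (rule exp_moment_of_extension[OF _ _ v(2)])
      show "g holomorphic_on {z. v < Re z}"
        by (rule holomorphic_on_subset[of _ "vstrip u \<infinity>"])
           (use g v in \<open>auto simp: is_hol_extension_def vstrip_def intro: less_trans\<close>)
    qed (use g in \<open>auto simp: is_hol_extension_def\<close>)
  qed
qed

text \<open>The integral formula itself realises the extension up to the abscissa. In particular the choice
  in \<open>bext\<close> is made from a nonempty set.\<close>

lemma B_is_extension: "is_hol_extension \<phi> (abscissa \<phi>) B"
proof -
  have "B field_differentiable at z within vstrip (abscissa \<phi>) \<infinity>" if "z \<in> vstrip (abscissa \<phi>) \<infinity>" for z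
  proof -
    have "abscissa \<phi> < ereal (Re z)" using that by (simp add: vstrip_def)
    from ereal_dense2[OF this] obtain x where "abscissa \<phi> < ereal x" "x < Re z" by auto
    then show ?thesis
      using B_differentiable[OF exp_moment_above_abscissa]
      by (auto simp: field_differentiable_def intro: has_field_derivative_at_within)
  qed
  then show ?thesis by (auto simp: is_hol_extension_def holomorphic_on_def B_eq)
qed

lemma bext_is_extension: "is_hol_extension \<phi> (abscissa \<phi>) (bext \<phi>)"
  unfolding bext_def by (rule someI[where P = "is_hol_extension \<phi> (abscissa \<phi>)", OF B_is_extension])

lemma bext_eq_B:
  assumes "abscissa \<phi> < Re z \<or> 0 \<le> Re z"
  shows "bext \<phi> z = B z"
  by (rule hol_extension_unique[OF bext_is_extension B_is_extension abscissa_le_0 assms])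

definition B_real :: "real \<Rightarrow> real" where
  "B_real x = q + d * x + (\<integral>y. (1 - exp (- x * y)) \<partial>\<mu>)"

lemma B_of_real: "B (of_real x) = of_real (B_real x)"
proof -
  have "(\<lambda>y. 1 - exp (- of_real x * complex_of_real y)) = (\<lambda>y. complex_of_real (1 - exp (- x * y)))"
    by (simp add: exp_of_real[symmetric])
  then show ?thesis by (simp only: B_def B_real_def integral_complex_of_real) simp
qed

lemma integrable_one_minus_exp_real:
  assumes "exp_moment x"
  shows "integrable \<mu> (\<lambda>y. 1 - exp (- x * y))"
proof -
  have "complex_integrable \<mu> (\<lambda>y. 1 - exp (- of_real x * complex_of_real y))"
    by (rule integrable_one_minus_exp) (use assms in simp)
  moreover have "(\<lambda>y. 1 - exp (- of_real x * complex_of_real y)) = (\<lambda>y. complex_of_real (1 - exp (- x * y)))"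
    by (simp add: exp_of_real[symmetric])
  ultimately show ?thesis by (simp only: complex_of_real_integrable_eq)
qed

text \<open>Since \<open>Re e\<^sup>-\<^sup>z\<^sup>y \<le> e\<^sup>-\<^sup>x\<^sup>y\<close> for \<open>x = Re z\<close>. This reduces the search for complex zeros to the
  real axis.\<close>

lemma Re_B_ge:
  assumes "exp_moment (Re z)"
  shows "B_real (Re z) \<le> Re (B z)"
proof -
  have i: "complex_integrable \<mu> (\<lambda>y. 1 - exp (- z * complex_of_real y))"
    by (rule integrable_one_minus_exp[OF assms])
  have "(\<integral>y. (1 - exp (- Re z * y)) \<partial>\<mu>) \<le> (\<integral>y. Re (1 - exp (- z * complex_of_real y)) \<partial>\<mu>)"
  proof (rule integral_mono)
    fix y
    have "Re (exp (- z * complex_of_real y)) \<le> exp (- Re z * y)"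
      using complex_Re_le_cmod[of "exp (- z * complex_of_real y)"] by simp
    then show "1 - exp (- Re z * y) \<le> Re (1 - exp (- z * complex_of_real y))" by simp
  qed (use integrable_Re[OF i] integrable_one_minus_exp_real[OF assms] in \<open>simp_all only:\<close>)
  also have "\<dots> = Re (\<integral>y. (1 - exp (- z * complex_of_real y)) \<partial>\<mu>)"
    by (rule integral_Re[OF i])
  finally show ?thesis by (simp add: B_def B_real_def)
qed

text \<open>The increment from \<open>x\<close> to \<open>x'\<close> is \<open>d (x' - x)\<close> plus the integral of the positive function
  \<open>e\<^sup>-\<^sup>x\<^sup>y - e\<^sup>-\<^sup>x\<^sup>'\<^sup>y\<close>. It is positive unless \<open>d = 0\<close> and \<open>\<mu>\<close> is null.\<close>

lemma B_real_strict_mono_or_B_const: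
  "(\<forall>z. B z = of_real q) \<or> (\<forall>x x'. exp_moment x \<longrightarrow> x < x' \<longrightarrow> B_real x < B_real x')"
proof (cases "d = 0 \<and> (AE y in \<mu>. False)")
  case True
  then have "(\<integral>y. (1 - exp (- z * complex_of_real y)) \<partial>\<mu>) = 0" for z
    by (intro integral_eq_zero_AE) auto
  then have "\<forall>z. B z = of_real q" unfolding B_def using True by simp
  then show ?thesis ..
next
  case False
  have "B_real x < B_real x'" if x: "exp_moment x" "x < x'" for x x'
  proof -
    have i: "integrable \<mu> (\<lambda>y. 1 - exp (- x * y))" "integrable \<mu> (\<lambda>y. 1 - exp (- x' * y))"
      using x by (intro integrable_one_minus_exp_real; auto intro: exp_moment_mono)+
    let ?D = "\<lambda>y. (1 - exp (- x' * y)) - (1 - exp (- x * y))"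
    have pos: "0 < ?D y" if "y \<in> space \<mu>" for y
      using that x(2) by (simp add: space_\<mu>)
    have int: "integrable \<mu> ?D" by (rule Bochner_Integration.integrable_diff[OF i(2) i(1)])
    have eq: "B_real x' - B_real x = d * (x' - x) + (\<integral>y. ?D y \<partial>\<mu>)"
      using Bochner_Integration.integral_diff[OF i(2) i(1)] by (simp add: B_real_def algebra_simps)
    have nn: "0 \<le> (\<integral>y. ?D y \<partial>\<mu>)"
      by (rule Bochner_Integration.integral_nonneg) (use pos less_imp_le in blast)
    have "d \<noteq> 0 \<or> (\<integral>y. ?D y \<partial>\<mu>) \<noteq> 0"
    proof (rule ccontr)
      assume "\<not> ?thesis"
      then have d: "d = 0" and "(\<integral>y. ?D y \<partial>\<mu>) = 0" by auto
      moreover have "AE y in \<mu>. 0 \<le> ?D y"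
        by (rule AE_I2) (use pos less_imp_le in blast)
      ultimately have "AE y in \<mu>. ?D y = 0"
        using integral_nonneg_eq_0_iff_AE[OF int] by blast
      then have "AE y in \<mu>. False"
        using AE_space by eventually_elim (use pos in fastforce)
      with False d show False by simp
    qed
    then have "0 < d * (x' - x) + (\<integral>y. ?D y \<partial>\<mu>)"
    proof
      assume "d \<noteq> 0"
      then have "0 < d * (x' - x)" using d_nonneg x(2) by simp
      then show ?thesis using nn by linarith
    next
      assume "(\<integral>y. ?D y \<partial>\<mu>) \<noteq> 0"
      then have "0 < (\<integral>y. ?D y \<partial>\<mu>)" using nn by linarith
      moreover have "0 \<le> d * (x' - x)" using d_nonneg x(2) by simp
      ultimately show ?thesis by linarith
    qed
    then show ?thesis using eq by linarith
  qed
  then show ?thesis by blast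
qed

lemma B_real_0: "B_real 0 = q"
  by (simp add: B_real_def)

lemma B_real_pos: assumes "0 < x" shows "0 < B_real x"
  using B_real_strict_mono_or_B_const
proof
  assume c: "\<forall>z. B z = of_real q"
  then have "q \<noteq> 0" using nontrivial B_eq by force
  moreover have "B_real x = q" using c B_of_real[of x] by simp
  ultimately show ?thesis using q_nonneg by simp
next
  assume "\<forall>x x'. exp_moment x \<longrightarrow> x < x' \<longrightarrow> B_real x < B_real x'"
  then have "B_real 0 < B_real x" using assms exp_moment_nonneg[of 0] by simp
  then show ?thesis using q_nonneg B_real_0 by simp
qed

lemma Re_\<phi>_pos: "0 < Re z \<Longrightarrow> 0 < Re (\<phi> z)"
  using Re_B_ge[of z] B_real_pos[of "Re z"] by (simp add: B_eq exp_moment_nonneg)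

end

section \<open>The Bernstein-gamma function on the right half-plane\<close>

context bernstein_rep
begin

definition dlog_\<phi> :: "complex \<Rightarrow> complex" where "dlog_\<phi> z = deriv \<phi> z / \<phi> z"
definition log_\<phi> :: "complex \<Rightarrow> complex" where "log_\<phi> z = Ln (\<phi> z)"

lemma \<phi>_derivative:
  assumes "0 < Re z"
  shows "(\<phi> has_field_derivative (of_real d + moment 1 z)) (at z)"
proof (rule has_field_derivative_transform_within_open[of B _ z "{z. 0 < Re z}"])
  show "(B has_field_derivative (of_real d + moment 1 z)) (at z)"
    by (rule B_differentiable[of 0]) (use assms in \<open>auto intro: exp_moment_nonneg\<close>)
qed (use assms in \<open>auto simp: open_halfspace_Re_gt B_eq\<close>)

lemma \<phi>_holomorphic: "\<phi> holomorphic_on {z. 0 < Re z}"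
  by (auto simp: holomorphic_on_def field_differentiable_def
      intro: has_field_derivative_at_within \<phi>_derivative)

text \<open>From \<open>x y e\<^sup>-\<^sup>x\<^sup>y \<le> 1 - e\<^sup>-\<^sup>x\<^sup>y\<close> under the integral; on the real axis this is the concavity bound
  \<open>x \<phi>'(x) \<le> \<phi>(x)\<close>.\<close>

lemma norm_deriv_\<phi>_le:
  assumes "0 < Re z"
  shows "norm (deriv \<phi> z) * Re z \<le> norm (\<phi> z)"
proof -
  define x where "x = Re z"
  have x: "0 < x" using assms by (simp add: x_def)
  have int: "complex_integrable \<mu> (\<lambda>y. of_real (y ^ Suc 0) * exp (- z * of_real y))"
    by (rule moment_integrable[of 0]) (use assms in \<open>auto intro: exp_moment_nonneg\<close>)
  have "norm (moment 1 z) \<le> (\<integral>y. norm (of_real (y ^ Suc 0) * exp (- z * of_real y)) \<partial>\<mu>)"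
    unfolding moment_def One_nat_def by (rule integral_norm_bound)
  also have "\<dots> \<le> (\<integral>y. (1 - exp (- x * y)) / x \<partial>\<mu>)"
  proof (rule integral_mono)
    show "integrable \<mu> (\<lambda>y. (1 - exp (- x * y)) / x)"
      by (intro integrable_divide integrable_one_minus_exp_real exp_moment_nonneg) (use x in auto)
    fix y assume "y \<in> space \<mu>"
    then have y: "0 < y" by (simp add: space_\<mu>)
    have "x * y + 1 \<le> exp (x * y)" using exp_ge_add_one_self[of "x * y"] by linarith
    then have "(x * y + 1) * exp (- x * y) \<le> exp (x * y) * exp (- x * y)"
      by (rule mult_right_mono) simp
    then have "x * (y * exp (- x * y)) \<le> 1 - exp (- x * y)"
      by (simp add: algebra_simps flip: exp_add)
    then show "norm (of_real (y ^ Suc 0) * exp (- z * of_real y)) \<le> (1 - exp (- x * y)) / x"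
      using y x by (simp add: norm_mult field_simps x_def)
  qed (intro integrable_norm int)
  also have "\<dots> = (\<integral>y. (1 - exp (- x * y)) \<partial>\<mu>) / x" by simp
  finally have m: "norm (moment 1 z) * x \<le> (\<integral>y. (1 - exp (- x * y)) \<partial>\<mu>)"
    using x by (simp add: field_simps)
  have "norm (deriv \<phi> z) \<le> d + norm (moment 1 z)"
    unfolding DERIV_imp_deriv[OF \<phi>_derivative[OF assms]]
    by (rule order_trans[OF norm_triangle_ineq]) (use d_nonneg in simp)
  then have "norm (deriv \<phi> z) * x \<le> (d + norm (moment 1 z)) * x"
    by (rule mult_right_mono) (use x in simp)
  also have "\<dots> \<le> B_real x" using m q_nonneg by (simp add: B_real_def algebra_simps)
  also have "\<dots> \<le> Re (\<phi> z)" using Re_B_ge[of z] x by (simp add: x_def B_eq exp_moment_nonneg)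
  also have "\<dots> \<le> norm (\<phi> z)" by (rule complex_Re_le_cmod)
  finally show ?thesis by (simp add: x_def)
qed

lemma \<phi>_nonzero: "0 < Re z \<Longrightarrow> \<phi> z \<noteq> 0"
  using Re_\<phi>_pos[of z] by auto

lemma norm_dlog_\<phi>_le: "0 < Re z \<Longrightarrow> norm (dlog_\<phi> z) \<le> 1 / Re z"
  using norm_deriv_\<phi>_le[of z] \<phi>_nonzero[of z] by (simp add: dlog_\<phi>_def norm_divide field_simps)

lemma log_\<phi>_derivative:
  assumes "0 < Re z"
  shows "(log_\<phi> has_field_derivative dlog_\<phi> z) (at z)"
proof -
  have "\<phi> z \<notin> \<real>\<^sub>\<le>\<^sub>0"
    using Re_\<phi>_pos[OF assms] by (auto simp: complex_nonpos_Reals_iff)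
  then show ?thesis
    unfolding log_\<phi>_def[abs_def] dlog_\<phi>_def
    using \<phi>_derivative[OF assms] DERIV_imp_deriv[OF \<phi>_derivative[OF assms]]
    by (auto intro!: derivative_eq_intros simp: divide_inverse mult.commute)
qed

lemma exp_log_\<phi>: "0 < Re z \<Longrightarrow> exp (log_\<phi> z) = \<phi> z"
  by (simp add: log_\<phi>_def \<phi>_nonzero)

lemma log_\<phi>_holomorphic: "log_\<phi> holomorphic_on {z. 0 < Re z}"
  by (auto simp: holomorphic_on_def field_differentiable_def
      intro: has_field_derivative_at_within log_\<phi>_derivative)

lemma dlog_\<phi>_holomorphic: "dlog_\<phi> holomorphic_on {z. 0 < Re z}"
  unfolding dlog_\<phi>_def[abs_def]
  by (intro holomorphic_intros \<phi>_holomorphic) (auto simp: open_halfspace_Re_gt \<phi>_nonzero)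

text \<open>Cauchy's estimate for the logarithmic derivative on the disc of radius \<open>Re z / 2\<close>.\<close>

lemma norm_deriv_dlog_\<phi>_le:
  assumes "0 < Re z"
  shows "norm (deriv dlog_\<phi> z) \<le> 4 / (Re z)\<^sup>2"
proof -
  have lt: "Re z - Re w \<le> norm (z - w)" for w
    using abs_Re_le_cmod[of "z - w"] by simp
  have sub: "cball z (Re z / 2) \<subseteq> {z. 0 < Re z}"
  proof
    fix w assume "w \<in> cball z (Re z / 2)"
    then show "w \<in> {z. 0 < Re z}" using lt[of w] assms by (simp add: dist_norm)
  qed
  have "norm ((deriv ^^ 1) dlog_\<phi> z) \<le> fact 1 * (2 / Re z) / (Re z / 2) ^ 1"
  proof (rule Cauchy_higher_deriv_bound[where y = 0])
    show "dlog_\<phi> holomorphic_on ball z (Re z / 2)"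
      by (rule holomorphic_on_subset[OF dlog_\<phi>_holomorphic]) (use sub in force)
    show "continuous_on (cball z (Re z / 2)) dlog_\<phi>"
      by (rule continuous_on_subset[OF holomorphic_on_imp_continuous_on[OF dlog_\<phi>_holomorphic] sub])
    fix w assume "w \<in> ball z (Re z / 2)"
    then have w: "Re z / 2 < Re w" using lt[of w] by (simp add: dist_norm)
    then have "norm (dlog_\<phi> w) \<le> 1 / Re w" by (intro norm_dlog_\<phi>_le) (use assms in linarith)
    also have "\<dots> < 1 / (Re z / 2)" by (rule divide_strict_left_mono) (use w assms in auto)
    finally show "dlog_\<phi> w \<in> ball 0 (2 / Re z)" by simp
  qed (use assms in auto)
  then show ?thesis by (simp add: power2_eq_square)
qed

text \<open>The remainder is \<open>O(c\<^sup>-\<^sup>2)\<close> for fixed \<open>z\<close>. With \<open>c = 1, 2, \<dots>\<close> this is the convergence of the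
  Weierstrass product for \<open>W\<close>.\<close>

lemma log_\<phi>_taylor:
  assumes "0 < c" "0 \<le> Re z"
  shows "norm (log_\<phi> (of_real c + z) - log_\<phi> (of_real c) - dlog_\<phi> (of_real c) * z) \<le> 4 / c\<^sup>2 * (norm z)\<^sup>2"
proof -
  let ?S = "{w. c \<le> Re w}"
  define f where "f i = (if i = 0 then log_\<phi> else if i = Suc 0 then dlog_\<phi> else deriv dlog_\<phi>)" for i :: nat
  have "norm (f 0 (of_real c + z) - (\<Sum>i\<le>1. f i (of_real c) * (of_real c + z - of_real c) ^ i / fact i))
      \<le> 4 / c\<^sup>2 * norm (of_real c + z - of_real c) ^ Suc 1 / fact 1"
  proof (rule complex_Taylor[of ?S])
    show "convex ?S" by (rule convex_halfspace_Re_ge)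
    fix i x assume x: "x \<in> ?S" and "i \<le> (1::nat)"
    then have x0: "0 < Re x" using assms by simp
    have "(dlog_\<phi> has_field_derivative deriv dlog_\<phi> x) (at x)"
      by (rule holomorphic_derivI[OF dlog_\<phi>_holomorphic]) (use x0 in \<open>auto simp: open_halfspace_Re_gt\<close>)
    moreover have "i = 0 \<or> i = 1" using \<open>i \<le> 1\<close> by auto
    ultimately show "(f i has_field_derivative f (Suc i) x) (at x within ?S)"
      using log_\<phi>_derivative[OF x0] by (auto simp: f_def intro: has_field_derivative_at_within)
  next
    fix x assume x: "x \<in> ?S"
    then have "norm (deriv dlog_\<phi> x) \<le> 4 / (Re x)\<^sup>2" using assms by (intro norm_deriv_dlog_\<phi>_le) auto
    also have "\<dots> \<le> 4 / c\<^sup>2"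
      using x assms by (intro divide_left_mono power_mono mult_pos_pos) auto
    finally show "norm (f (Suc 1) x) \<le> 4 / c\<^sup>2" by (simp add: f_def)
  qed (use assms in auto)
  then show ?thesis by (simp add: f_def power2_eq_square algebra_simps)
qed

lemma log_\<phi>_shift_tendsto_0:
  assumes "0 \<le> Re z"
  shows "(\<lambda>n. log_\<phi> (of_nat (Suc n) + z) - log_\<phi> (of_nat (Suc n))) \<longlonglongrightarrow> 0"
proof (rule Lim_null_comparison)
  show "\<forall>\<^sub>F n in sequentially. norm (log_\<phi> (of_nat (Suc n) + z) - log_\<phi> (of_nat (Suc n))) \<le> 1 / real (Suc n) * norm z"
  proof (intro always_eventually allI)
    fix n
    have "norm (log_\<phi> (of_nat (Suc n) + z) - log_\<phi> (of_nat (Suc n)))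
        \<le> 1 / real (Suc n) * norm (of_nat (Suc n) + z - of_nat (Suc n))"
    proof (rule field_differentiable_bound[OF convex_halfspace_Re_ge[of "real (Suc n)"]])
      fix w assume w: "w \<in> {w. real (Suc n) \<le> Re w}"
      then have w0: "0 < Re w" by simp
      show "(log_\<phi> has_field_derivative dlog_\<phi> w) (at w within {w. real (Suc n) \<le> Re w})"
        by (rule has_field_derivative_at_within[OF log_\<phi>_derivative[OF w0]])
      have "norm (dlog_\<phi> w) \<le> 1 / Re w" by (rule norm_dlog_\<phi>_le[OF w0])
      also have "\<dots> \<le> 1 / real (Suc n)" using w by (intro divide_left_mono) auto
      finally show "norm (dlog_\<phi> w) \<le> 1 / real (Suc n)" .
    qed (use assms in auto)
    then show "norm (log_\<phi> (of_nat (Suc n) + z) - log_\<phi> (of_nat (Suc n))) \<le> 1 / real (Suc n) * norm z" by simp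
  qed
  show "(\<lambda>n. 1 / real (Suc n) * norm z) \<longlonglongrightarrow> 0"
    using tendsto_mult_left_zero[OF LIMSEQ_Suc[OF lim_1_over_n], of "norm z"] by simp
qed

text \<open>Logarithms of the factors of the product for \<open>W\<close>; the index is shifted so that it starts at
  \<open>0\<close>.\<close>

definition W_term :: "nat \<Rightarrow> complex \<Rightarrow> complex" where
  "W_term k z = log_\<phi> (of_nat (Suc k)) - log_\<phi> (of_nat (Suc k) + z) + dlog_\<phi> (of_nat (Suc k)) * z"

definition W_log :: "complex \<Rightarrow> complex" where
  "W_log z = (\<Sum>k. W_term k z)"

lemma norm_W_term_le:
  assumes "0 \<le> Re z" "norm z \<le> R"
  shows "norm (W_term k z) \<le> 4 * R\<^sup>2 * inverse (real (Suc k) ^ 2)"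
proof -
  have "norm (W_term k z) \<le> 4 / (real (Suc k))\<^sup>2 * (norm z)\<^sup>2"
    using log_\<phi>_taylor[of "real (Suc k)" z] assms(1)
    by (simp add: W_term_def norm_minus_commute algebra_simps)
  also have "\<dots> \<le> 4 / (real (Suc k))\<^sup>2 * R\<^sup>2"
    by (intro mult_left_mono power_mono assms) auto
  finally show ?thesis by (simp add: field_simps)
qed

lemma summable_W_bound: "summable (\<lambda>k. 4 * R\<^sup>2 * inverse (real (Suc k) ^ 2))"
  using inverse_power_summable[of 2, where 'a = real]
  by (intro summable_mult) (subst summable_Suc_iff[of "\<lambda>k. inverse (real k ^ 2)"], simp)

lemma W_term_summable: "0 \<le> Re z \<Longrightarrow> summable (\<lambda>k. W_term k z)"
  by (rule summable_comparison_test'[OF summable_W_bound[of "norm z"]]) (rule norm_W_term_le; simp)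

lemma W_log_holomorphic: "W_log holomorphic_on {z. 0 < Re z}"
proof (rule holomorphic_uniform_sequence[of _ "\<lambda>n z. \<Sum>k<n. W_term k z"])
  show "open {z. 0 < Re z}" by (rule open_halfspace_Re_gt)
  have "(\<lambda>z. log_\<phi> (of_nat (Suc k) + z)) holomorphic_on {z. 0 < Re z}" for k
  proof -
    have "(log_\<phi> \<circ> (\<lambda>z. of_nat (Suc k) + z)) holomorphic_on {z. 0 < Re z}"
      by (rule holomorphic_on_compose_gen[OF _ log_\<phi>_holomorphic], intro holomorphic_intros) auto
    then show ?thesis by (simp only: o_def)
  qed
  then show "(\<lambda>z. \<Sum>k<n. W_term k z) holomorphic_on {z. 0 < Re z}" for n
    unfolding W_term_def by (intro holomorphic_intros)
  fix x :: complex assume x: "x \<in> {z. 0 < Re z}"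
  let ?d = "Re x / 2"
  have sub: "cball x ?d \<subseteq> {z. 0 < Re z}"
  proof
    fix w assume "w \<in> cball x ?d"
    then show "w \<in> {z. 0 < Re z}" using abs_Re_le_cmod[of "x - w"] x by (simp add: dist_norm)
  qed
  have "uniform_limit (cball x ?d) (\<lambda>n z. \<Sum>k<n. W_term k z) W_log sequentially"
    unfolding W_log_def[abs_def]
  proof (rule Weierstrass_m_test[OF _ summable_W_bound])
    fix k w assume w: "w \<in> cball x ?d"
    have "norm w \<le> norm x + ?d"
      using w norm_triangle_sub[of w x] by (simp add: dist_norm norm_minus_commute)
    then show "norm (W_term k w) \<le> 4 * (norm x + ?d)\<^sup>2 * inverse (real (Suc k) ^ 2)"
      using sub w by (intro norm_W_term_le) auto
  qed
  then show "\<exists>d>0. cball x d \<subseteq> {z. 0 < Re z} \<and>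
      uniform_limit (cball x d) (\<lambda>n z. \<Sum>k<n. W_term k z) W_log sequentially"
    using x sub by (intro exI[of _ ?d]) auto
qed

lemma bg_W_half_eq:
  assumes "0 < Re z"
  shows "bg_W_half \<phi> z = exp (- of_real (gamma_const \<phi>) * z - log_\<phi> z + W_log z)"
proof -
  have "\<phi> (of_nat (Suc k)) / \<phi> (of_nat (Suc k) + z)
      * exp (deriv \<phi> (of_nat (Suc k)) / \<phi> (of_nat (Suc k)) * z) = exp (W_term k z)" for k
    using assms by (simp add: W_term_def exp_add exp_diff exp_log_\<phi> dlog_\<phi>_def)
  then have "(\<Prod>k. \<phi> (of_nat (Suc k)) / \<phi> (of_nat (Suc k) + z)
      * exp (deriv \<phi> (of_nat (Suc k)) / \<phi> (of_nat (Suc k)) * z)) = exp (W_log z)"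
    using prodinf_exp[OF W_term_summable, of z] assms by (simp only: W_log_def)
  then show ?thesis
    using assms by (simp add: bg_W_half_def exp_add exp_diff exp_log_\<phi>)
qed

lemma bg_W_half_nonzero: "0 < Re z \<Longrightarrow> bg_W_half \<phi> z \<noteq> 0"
  by (simp add: bg_W_half_eq)

lemma bg_W_half_holomorphic: "bg_W_half \<phi> holomorphic_on {z. 0 < Re z}"
  by (subst holomorphic_cong[OF refl bg_W_half_eq])
     (auto intro!: holomorphic_intros log_\<phi>_holomorphic W_log_holomorphic)

text \<open>The sequence that defines \<open>gamma_const\<close> is a partial sum of \<open>W_log 1\<close>, up to the constant \<open>Ln \<phi>(1)\<close>
  and the difference \<open>Ln \<phi>(n + 1) - Ln \<phi>(n)\<close>, which tends to \<open>0\<close>.\<close>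

lemma gamma_tendsto:
  "(\<lambda>n. (\<Sum>k=1..n. Re (deriv \<phi> (of_nat k) / \<phi> (of_nat k))) - ln (Re (\<phi> (of_nat n))))
     \<longlonglongrightarrow> Re (W_log 1 - log_\<phi> 1)" (is "?g \<longlonglongrightarrow> _")
proof (rule LIMSEQ_imp_Suc)
  have partial: "(\<Sum>k<n. W_term k 1) = log_\<phi> 1 - log_\<phi> (of_nat (Suc n)) + (\<Sum>k<n. dlog_\<phi> (of_nat (Suc k)))" for n
    by (induction n) (simp_all add: W_term_def algebra_simps)
  have log_\<phi>_Suc: "Re (log_\<phi> (of_nat (Suc n))) = ln (Re (\<phi> (of_nat (Suc n))))" for n
    using B_of_real[of "real (Suc n)"] B_real_pos[of "real (Suc n)"]
    by (simp add: log_\<phi>_def B_eq Ln_of_real)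
  have shift: "(\<Sum>k<n. Re (dlog_\<phi> (of_nat (Suc k)))) = (\<Sum>k=1..n. Re (deriv \<phi> (of_nat k) / \<phi> (of_nat k)))" for n
    unfolding dlog_\<phi>_def using sum.atLeast1_atMost_eq[of "\<lambda>k. Re (deriv \<phi> (of_nat k) / \<phi> (of_nat k))" n]
    by (simp only: One_nat_def)
  have eq: "?g (Suc n) = Re ((\<Sum>k<Suc n. W_term k 1) - log_\<phi> 1
      + (log_\<phi> (of_nat (Suc n) + 1) - log_\<phi> (of_nat (Suc n))))" for n
  proof -
    have "of_nat (Suc n) + (1::complex) = of_nat (Suc (Suc n))" by simp
    then show ?thesis
      unfolding partial by (simp only: minus_complex.sel plus_complex.sel Re_sum log_\<phi>_Suc shift)
  qed
  have "(\<lambda>n. (\<Sum>k<Suc n. W_term k 1) - log_\<phi> 1 + (log_\<phi> (of_nat (Suc n) + 1) - log_\<phi> (of_nat (Suc n)))) 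
      \<longlonglongrightarrow> W_log 1 - log_\<phi> 1 + 0"
    unfolding W_log_def
    by (intro tendsto_intros log_\<phi>_shift_tendsto_0 LIMSEQ_Suc summable_LIMSEQ W_term_summable) auto
  from tendsto_Re[OF this] show "(\<lambda>n. ?g (Suc n)) \<longlonglongrightarrow> Re (W_log 1 - log_\<phi> 1)"
    by (simp only: eq add_0_right)
qed

lemma log_\<phi>_real: "0 < x \<Longrightarrow> log_\<phi> (of_real x) \<in> \<real>"
  using B_of_real[of x] B_real_pos[of x] by (simp add: log_\<phi>_def B_eq Ln_of_real)

text \<open>All terms involved are real, so nothing is lost by the real parts in \<open>gamma_const\<close>. The identity
  is the normalisation \<open>W(1) = 1\<close> in disguise.\<close>

lemma gamma_const_eq: "of_real (gamma_const \<phi>) = W_log 1 - log_\<phi> 1"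
proof -
  have real: "log_\<phi> (of_nat (Suc n)) \<in> \<real>" for n
    using log_\<phi>_real[of "real (Suc n)"] by simp
  have "dlog_\<phi> (of_nat (Suc n)) \<in> \<real>" for n
    using DERIV_imp_deriv[OF \<phi>_derivative, of "of_nat (Suc n)"] moment_of_real[of 1 "real (Suc n)"]
      B_of_real[of "real (Suc n)"]
    by (auto simp: dlog_\<phi>_def B_eq simp del: of_nat_Suc intro!: Reals_divide Reals_add)
  then have "W_term k 1 \<in> \<real>" for k
    using real[of k] real[of "Suc k"] by (auto simp: W_term_def add_ac)
  then have "W_log 1 \<in> \<real>"
    unfolding W_log_def
    using W_term_summable[of 1] closed_complex_Reals summable_LIMSEQ[of "\<lambda>k. W_term k 1"]
    by (intro Lim_in_closed_set[of \<real> "\<lambda>n. \<Sum>k<n. W_term k 1" sequentially]) auto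
  then have "W_log 1 - log_\<phi> 1 \<in> \<real>" using real[of 0] by auto
  then have "of_real (Re (W_log 1 - log_\<phi> 1)) = W_log 1 - log_\<phi> 1" by (rule of_real_Re)
  then show ?thesis unfolding gamma_const_def using limI[OF gamma_tendsto] by simp
qed

lemma bg_W_half_1: "bg_W_half \<phi> 1 = 1"
  by (simp add: bg_W_half_eq gamma_const_eq)

text \<open>The difference \<open>W_log (z + 1) - W_log z - W_log 1\<close> telescopes.\<close>

lemma bg_W_half_recurrence:
  assumes z: "0 < Re z"
  shows "bg_W_half \<phi> (z + 1) = \<phi> z * bg_W_half \<phi> z"
proof -
  have "W_term k (z + 1) - W_term k z - W_term k 1 =
      (log_\<phi> (of_nat (Suc k) + z) - log_\<phi> (of_nat (Suc k))) - (log_\<phi> (of_nat (Suc (Suc k)) + z) - log_\<phi> (of_nat (Suc (Suc k))))" for k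
    by (simp add: W_term_def algebra_simps)
  then have "(\<lambda>k. W_term k (z + 1) - W_term k z - W_term k 1) sums
      (log_\<phi> (of_nat (Suc 0) + z) - log_\<phi> (of_nat (Suc 0)) - 0)"
    using telescope_sums'[OF log_\<phi>_shift_tendsto_0[of z]] z by simp
  moreover have "(\<lambda>k. W_term k (z + 1) - W_term k z - W_term k 1) sums
      (W_log (z + 1) - W_log z - W_log 1)"
    unfolding W_log_def by (intro sums_diff summable_sums W_term_summable) (use z in auto)
  ultimately have "W_log (z + 1) - W_log z - W_log 1 = log_\<phi> (1 + z) - log_\<phi> 1"
    using sums_unique2 by fastforce
  then have "- of_real (gamma_const \<phi>) * (z + 1) - log_\<phi> (z + 1) + W_log (z + 1)
      = log_\<phi> z + (- of_real (gamma_const \<phi>) * z - log_\<phi> z + W_log z)"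
    unfolding gamma_const_eq by (simp add: algebra_simps)
  then have "exp (- of_real (gamma_const \<phi>) * (z + 1) - log_\<phi> (z + 1) + W_log (z + 1))
      = exp (log_\<phi> z) * exp (- of_real (gamma_const \<phi>) * z - log_\<phi> z + W_log z)"
    by (simp only: exp_add)
  then show ?thesis using z by (simp add: bg_W_half_eq exp_log_\<phi>)
qed

end

section \<open>Continuation of the Bernstein-gamma function and zeros of Bernstein functions\<close>

context bernstein_rep
begin

lemma bext_eq_\<phi>: "0 \<le> Re z \<Longrightarrow> bext \<phi> z = \<phi> z"
  by (simp add: bext_eq_B B_eq)

lemma bext_holomorphic: "bext \<phi> holomorphic_on vstrip (abscissa \<phi>) \<infinity>"
  using bext_is_extension by (simp add: is_hol_extension_def)

text \<open>The definition of \<open>bg_W\<close> applies the recurrence the least possible number of times, so its formula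
  changes from one vertical strip to the next. Any larger number \<open>N\<close> gives the same value, which
  provides one formula on a whole neighbourhood of each point.\<close>

lemma bg_W_eq:
  assumes "0 < Re z + real N"
  shows "bg_W \<phi> z = bg_W_half \<phi> (z + of_nat N) / (\<Prod>k<N. bext \<phi> (z + of_nat k))"
proof -
  define n where "n = nat (\<lfloor>- Re z\<rfloor> + 1)"
  have n: "0 < Re z + real n"
    unfolding n_def by linarith
  have "n \<le> N"
    using assms unfolding n_def by linarith
  then show ?thesis
  proof (induction N rule: dec_induct)
    case base
    then show ?case by (simp add: bg_W_def Let_def flip: n_def)
  next
    case (step m)
    have pos: "0 < Re (z + of_nat m)" using step.hyps n by simp
    have "bg_W_half \<phi> (z + of_nat (Suc m)) = \<phi> (z + of_nat m) * bg_W_half \<phi> (z + of_nat m)"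
      using bg_W_half_recurrence[OF pos] by (simp add: add_ac)
    then show ?case
      using step.IH \<phi>_nonzero[OF pos] bext_eq_\<phi>[of "z + of_nat m"] pos by simp
  qed
qed

text \<open>Locally the reciprocal is \<open>(\<Prod>k<N. \<phi>(z + k)) / W(z + N)\<close>, whose denominator has no zeros. The
  identity holds even at a pole of \<open>W\<close>: there \<open>bg_W\<close> is \<open>0\<close> as a quotient by \<open>0\<close>, and so is its
  inverse.\<close>

lemma inverse_bg_W_holomorphic: "(\<lambda>z. inverse (bg_W \<phi> z)) holomorphic_on vstrip (abscissa \<phi>) \<infinity>"
proof -
  have "(\<lambda>z. inverse (bg_W \<phi> z)) analytic_on {z}" if z: "z \<in> vstrip (abscissa \<phi>) \<infinity>" for z
  proof -
    obtain N where N: "- Re z < real N" using reals_Archimedean2 by blast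
    let ?U = "vstrip (abscissa \<phi>) \<infinity> \<inter> {w. - real N < Re w}"
    have shift: "abscissa \<phi> < ereal (Re w + real k)" if "abscissa \<phi> < ereal (Re w)" for w k
      using that by (rule less_le_trans) simp
    have ext: "(\<lambda>w. bext \<phi> (w + of_nat k)) holomorphic_on ?U" for k
    proof -
      have "(bext \<phi> \<circ> (\<lambda>w. w + of_nat k)) holomorphic_on ?U"
        by (rule holomorphic_on_compose_gen[OF _ bext_holomorphic], intro holomorphic_intros)
           (auto simp: vstrip_def shift)
      then show ?thesis by (simp only: o_def)
    qed
    have half: "(\<lambda>w. bg_W_half \<phi> (w + of_nat N)) holomorphic_on ?U"
    proof -
      have "(bg_W_half \<phi> \<circ> (\<lambda>w. w + of_nat N)) holomorphic_on ?U"
        by (rule holomorphic_on_compose_gen[OF _ bg_W_half_holomorphic], intro holomorphic_intros) auto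
      then show ?thesis by (simp only: o_def)
    qed
    have "(\<lambda>w. (\<Prod>k<N. bext \<phi> (w + of_nat k)) / bg_W_half \<phi> (w + of_nat N)) holomorphic_on ?U"
      by (intro holomorphic_intros ext half) (auto intro!: bg_W_half_nonzero)
    moreover have "inverse (bg_W \<phi> w)
        = (\<Prod>k<N. bext \<phi> (w + of_nat k)) / bg_W_half \<phi> (w + of_nat N)" if "w \<in> ?U" for w
      using bg_W_eq[of w N] that by simp
    ultimately have "(\<lambda>w. inverse (bg_W \<phi> w)) holomorphic_on ?U"
      by (metis (no_types, lifting) holomorphic_cong)
    moreover have "open ?U" by (intro open_Int open_vstrip open_halfspace_Re_gt)
    ultimately show ?thesis using N z by (auto simp: analytic_at)
  qed
  then show ?thesis
    using analytic_on_analytic_at analytic_imp_holomorphic by blast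
qed

lemma inverse_bg_W_analytic:
  "abscissa \<phi> < ereal (Re z) \<Longrightarrow> (\<lambda>z. inverse (bg_W \<phi> z)) analytic_on {z}"
  unfolding analytic_at
  by (intro exI[of _ "vstrip (abscissa \<phi>) \<infinity>"] conjI open_vstrip inverse_bg_W_holomorphic)
     (simp add: vstrip_def)

lemma bg_W_analytic:
  assumes "abscissa \<phi> < ereal (Re z)" "bg_W \<phi> z \<noteq> 0"
  shows "bg_W \<phi> analytic_on {z}"
proof -
  have "(\<lambda>z. inverse (inverse (bg_W \<phi> z))) analytic_on {z}"
    by (intro analytic_on_inverse inverse_bg_W_analytic assms) (use assms in auto)
  then show ?thesis by simp
qed

lemma bg_W_Suc: "bg_W \<phi> (of_nat (Suc n)) = (\<Prod>k=1..n. \<phi> (of_nat k))"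
proof -
  have "bg_W_half \<phi> (of_nat (Suc n)) = (\<Prod>k=1..n. \<phi> (of_nat k))"
  proof (induction n)
    case (Suc n)
    then show ?case
      using bg_W_half_recurrence[of "of_nat (Suc n)"] by (simp add: add_ac mult.commute)
  qed (simp add: bg_W_half_1)
  then show ?thesis using bg_W_eq[of "of_nat (Suc n)" 0] by simp
qed

lemma inverse_bg_W_minus_nat:
  "inverse (bg_W \<phi> (- of_nat n)) = (\<Prod>k\<le>n. bext \<phi> (- of_nat k))"
proof -
  have "bg_W \<phi> (- of_nat n) = inverse (\<Prod>k<Suc n. bext \<phi> (- of_nat n + of_nat k))"
    using bg_W_eq[of "- of_nat n" "Suc n"] by (simp add: bg_W_half_1 divide_inverse del: prod.lessThan_Suc)
  also have "(\<Prod>k<Suc n. bext \<phi> (- of_nat n + of_nat k)) = (\<Prod>k<Suc n. bext \<phi> (- of_nat (Suc n - Suc k)))"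
    by (intro prod.cong refl) (auto simp: of_nat_diff)
  also have "\<dots> = (\<Prod>k<Suc n. bext \<phi> (- of_nat k))"
    by (rule prod.nat_diff_reindex)
  finally show ?thesis by (simp only: lessThan_Suc_atMost inverse_inverse_eq)
qed

lemma bext_of_real: "abscissa \<phi> < ereal x \<Longrightarrow> bext \<phi> (of_real x) = of_real (B_real x)"
  by (simp add: bext_eq_B B_of_real)

lemma B_real_isCont:
  assumes "abscissa \<phi> < ereal x"
  shows "isCont B_real x"
proof -
  obtain y where y: "abscissa \<phi> < ereal y" "y < x" using ereal_dense2[OF assms] by auto
  have "isCont B (of_real x)"
    using B_differentiable[OF exp_moment_above_abscissa[OF y(1)], of "of_real x"] y(2)
    by (auto intro: DERIV_isCont)
  then have "isCont (\<lambda>x. B (of_real x)) x"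
    by (intro isCont_o2[of x of_real B]) auto
  then have "isCont (\<lambda>x. Re (B (of_real x))) x" by (rule isCont_Re)
  then show ?thesis by (simp add: B_of_real)
qed

text \<open>The set whose supremum is \<open>largest_zero \<phi>\<close>. It may contain the abscissa itself, where
  \<open>bext \<phi>\<close> is in general not determined, so membership is a statement about right limits.\<close>

definition zero_limits :: "real set" where
  "zero_limits = {u. abscissa \<phi> \<le> ereal u \<and> u \<le> 0 \<and>
                      ((\<lambda>x. bext \<phi> (of_real x)) \<longlongrightarrow> 0) (at_right u)}"

lemma largest_zero_eq: "largest_zero \<phi> = Sup (ereal ` zero_limits)"
  unfolding largest_zero_def zero_limits_def by (rule arg_cong[of _ _ Sup]) auto

lemma zero_limit_B_real:
  assumes "u \<in> zero_limits"
  shows "(B_real \<longlongrightarrow> 0) (at_right u)"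
proof -
  have "\<forall>\<^sub>F x in at_right u. Re (bext \<phi> (of_real x)) = B_real x"
    using eventually_at_right_less[of u]
  proof eventually_elim
    case (elim x)
    have "abscissa \<phi> < ereal x"
      using assms elim by (auto simp: zero_limits_def intro: le_less_trans)
    then show ?case by (simp add: bext_of_real)
  qed
  moreover have "((\<lambda>x. Re (bext \<phi> (of_real x))) \<longlongrightarrow> Re 0) (at_right u)"
    using assms by (intro tendsto_Re) (simp add: zero_limits_def)
  ultimately show ?thesis using tendsto_cong by fastforce
qed

lemma B_real_zero_iff_zero_limit:
  assumes x: "abscissa \<phi> < ereal x" "x \<le> 0"
  shows "B_real x = 0 \<longleftrightarrow> x \<in> zero_limits"
proof
  have lim: "(B_real \<longlongrightarrow> B_real x) (at_right x)"
    using B_real_isCont[OF x(1)] by (auto simp: isCont_def intro: filterlim_mono at_le)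
  {
    assume "B_real x = 0"
    then have "((\<lambda>y. complex_of_real (B_real y)) \<longlongrightarrow> of_real 0) (at_right x)"
      using lim by (intro tendsto_of_real) simp
    moreover have "\<forall>\<^sub>F y in at_right x. complex_of_real (B_real y) = bext \<phi> (of_real y)"
      using eventually_at_right_less[of x]
    proof eventually_elim
      case (elim y)
      have "abscissa \<phi> < ereal y" using x(1) elim by (auto intro: less_trans)
      then show ?case by (simp add: bext_of_real)
    qed
    ultimately have "((\<lambda>y. bext \<phi> (of_real y)) \<longlongrightarrow> 0) (at_right x)"
      using tendsto_cong by fastforce
    then show "x \<in> zero_limits" using x by (simp add: zero_limits_def)
  }
  assume "x \<in> zero_limits"
  from tendsto_unique[OF _ zero_limit_B_real[OF this] lim] show "B_real x = 0" by simp
qed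

text \<open>At \<open>v\<close>, which lies to the right of the abscissa, \<open>\<phi>\<close> is continuous and vanishes. Strict monotonicity
  then makes it negative and bounded away from \<open>0\<close> just to the right of \<open>u\<close>.\<close>

lemma zero_limits_unique:
  assumes u: "u \<in> zero_limits" and v: "v \<in> zero_limits" and "u < v"
  shows False
proof -
  have mom: "exp_moment y" if "u < y" for y
    by (rule exp_moment_above_abscissa)
       (use u that in \<open>auto simp: zero_limits_def intro: le_less_trans\<close>)
  have "B_real v = 0"
  proof (subst B_real_zero_iff_zero_limit)
    have "abscissa \<phi> \<le> ereal u" "ereal u < ereal v" using u \<open>u < v\<close> by (auto simp: zero_limits_def)
    then show "abscissa \<phi> < ereal v" by (rule le_less_trans)
  qed (use v in \<open>auto simp: zero_limits_def\<close>)
  have "\<not> (\<forall>z. B z = of_real q)"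
  proof
    assume c: "\<forall>z. B z = of_real q"
    then have "q = 0" using B_of_real[of v] \<open>B_real v = 0\<close> by simp
    then show False using c nontrivial B_eq by force
  qed
  then have mono: "B_real x < B_real x'" if "exp_moment x" "x < x'" for x x'
    using B_real_strict_mono_or_B_const that by blast
  define m where "m = (u + v) / 2"
  have m: "u < m" "m < v" using \<open>u < v\<close> by (auto simp: m_def)
  have "\<forall>\<^sub>F y in at_right u. B_real y \<le> B_real m"
    using eventually_at_right_real[OF m(1)]
  proof eventually_elim
    case (elim y)
    then show ?case using mono[of y m] mom[of y] by auto
  qed
  then have "0 \<le> B_real m"
    by (rule tendsto_upperbound[OF zero_limit_B_real[OF u]]) simp
  moreover have "B_real m < B_real v" using mono mom m by blast
  ultimately show False using \<open>B_real v = 0\<close> by simp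
qed

lemma largest_zero_real:
  assumes "u \<in> zero_limits"
  shows "largest_zero \<phi> = ereal u"
proof -
  have "zero_limits = {u}" using assms zero_limits_unique by (auto intro: linorder_neqE)
  then show ?thesis by (simp add: largest_zero_eq)
qed

lemma largest_zero_in_zero_limits:
  assumes "largest_zero \<phi> = ereal u"
  shows "u \<in> zero_limits"
proof -
  have "zero_limits \<noteq> {}"
    using assms by (auto simp: largest_zero_eq bot_ereal_def)
  then obtain v where "v \<in> zero_limits" by auto
  then show ?thesis using largest_zero_real assms by fastforce
qed

lemma bext_real_zero_iff:
  assumes "abscissa \<phi> < ereal x" "x \<le> 0"
  shows "bext \<phi> (of_real x) = 0 \<longleftrightarrow> largest_zero \<phi> = ereal x"
  unfolding bext_of_real[OF assms(1)] of_real_eq_0_iff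
  using B_real_zero_iff_zero_limit[OF assms] largest_zero_real largest_zero_in_zero_limits by blast

lemma largest_zero_le_0: "largest_zero \<phi> \<le> 0"
  unfolding largest_zero_eq by (rule Sup_least) (auto simp: zero_limits_def zero_ereal_def)

lemma abar_le_0: "abar \<phi> \<le> 0"
  by (simp add: abar_def abscissa_le_0 largest_zero_le_0)

lemma abscissa_le_abar: "abscissa \<phi> \<le> abar \<phi>"
  by (simp add: abar_def)

text \<open>If the value at \<open>x \<le> 0\<close> were not positive, the intermediate value theorem on \<open>[x, 0]\<close> would produce
  a zero to the right of \<open>largest_zero \<phi>\<close>, because the value at \<open>0\<close> is \<open>q \<ge> 0\<close>.\<close>

lemma B_real_pos_above_abar:
  assumes "abar \<phi> < ereal x"
  shows "0 < B_real x"
proof (cases "0 < x")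
  case True
  then show ?thesis by (rule B_real_pos)
next
  case False
  have x: "abscissa \<phi> < ereal x" "largest_zero \<phi> < ereal x"
    using assms by (auto simp: abar_def)
  show ?thesis
  proof (rule ccontr)
    assume "\<not> 0 < B_real x"
    then have "\<exists>y. x \<le> y \<and> y \<le> 0 \<and> B_real y = 0"
      using False q_nonneg B_real_0 x(1)
      by (intro IVT') (auto intro!: continuous_at_imp_continuous_on B_real_isCont intro: less_le_trans)
    then obtain y where y: "x \<le> y" "y \<le> 0" "B_real y = 0" by blast
    have "abscissa \<phi> < ereal y" using x(1) y(1) by (auto intro: less_le_trans)
    then have "largest_zero \<phi> = ereal y"
      using B_real_zero_iff_zero_limit y largest_zero_real by blast
    then show False using x(2) y(1) by simp
  qed
qed

lemma bext_nonzero: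
  assumes "abar \<phi> < ereal (Re z)"
  shows "bext \<phi> z \<noteq> 0"
proof -
  have a: "abscissa \<phi> < ereal (Re z)" using assms by (auto simp: abar_def)
  have "0 < Re (B z)"
    using Re_B_ge[OF exp_moment_above_abscissa[OF a]] B_real_pos_above_abar[OF assms] by linarith
  then show ?thesis using bext_eq_B[of z] a by auto
qed

lemma bg_W_nonzero_iff:
  assumes "0 < Re z + real N"
  shows "bg_W \<phi> z \<noteq> 0 \<longleftrightarrow> (\<forall>k<N. bext \<phi> (z + of_nat k) \<noteq> 0)"
  unfolding bg_W_eq[OF assms] using bg_W_half_nonzero[of "z + of_nat N"] assms by (simp add: Ball_def)

lemma bg_W_nonzero:
  assumes "abar \<phi> < ereal (Re z)"
  shows "bg_W \<phi> z \<noteq> 0"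
proof -
  obtain N where N: "- Re z < real N" using reals_Archimedean2 by blast
  have "abar \<phi> < ereal (Re (z + of_nat k))" for k
    using assms by (rule less_le_trans) simp
  then show ?thesis using bg_W_nonzero_iff[of z N] bext_nonzero N by auto
qed

lemma bg_W_analytic_above_abar: "abar \<phi> < ereal (Re z) \<Longrightarrow> bg_W \<phi> analytic_on {z}"
  by (intro bg_W_analytic bg_W_nonzero) (auto simp: abar_def)

end

section \<open>Behaviour of a Bernstein function on the imaginary axis\<close>

lemma norm_one_minus_exp_le:
  fixes w :: complex
  assumes "0 \<le> Re w"
  shows "norm (1 - exp (- w)) \<le> norm w"
proof -
  have "norm (exp 0 - exp (- w)) \<le> 1 * norm (0 - (- w))"
  proof (rule field_differentiable_bound[OF convex_halfspace_Re_le[of 0], where f' = exp])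
    fix z :: complex assume "z \<in> {z. Re z \<le> 0}"
    then show "norm (exp z) \<le> 1" by simp
  qed (use assms in \<open>auto intro: DERIV_subset[OF DERIV_exp]\<close>)
  then show ?thesis by simp
qed

context bernstein_rep
begin

lemma \<phi>_0: "\<phi> 0 = of_real q"
  by (simp add: \<phi>_eq)

lemma \<phi>_continuous: "continuous_on {z. 0 \<le> Re z} \<phi>"
  unfolding continuous_on_sequentially
proof (intro allI ballI impI)
  fix Z :: "nat \<Rightarrow> complex" and z
  assume z: "z \<in> {z. 0 \<le> Re z}" and Z: "(\<forall>n. Z n \<in> {z. 0 \<le> Re z}) \<and> Z \<longlonglongrightarrow> z"
  have "Bseq Z" using Z convergent_imp_Bseq convergentI by blast
  then obtain R where R: "0 < R" "\<And>n. norm (Z n) \<le> R" by (auto elim: BseqE)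
  have "(\<lambda>n. \<integral>y. (1 - exp (- Z n * of_real y)) \<partial>\<mu>) \<longlonglongrightarrow> (\<integral>y. (1 - exp (- z * of_real y)) \<partial>\<mu>)"
  proof (rule integral_dominated_convergence)
    show "integrable \<mu> (\<lambda>y. (2 + R) * min 1 y)"
      by (rule integrable_mult_right[OF integrable_min])
    show "AE y in \<mu>. (\<lambda>n. 1 - exp (- Z n * complex_of_real y)) \<longlonglongrightarrow> 1 - exp (- z * complex_of_real y)"
      using Z by (intro AE_I2 tendsto_intros) auto
    show "AE y in \<mu>. norm (1 - exp (- Z n * complex_of_real y)) \<le> (2 + R) * min 1 y" for n
    proof (rule AE_I2)
      fix y assume "y \<in> space \<mu>"
      then have y: "0 < y" by (simp add: space_\<mu>)
      show "norm (1 - exp (- Z n * complex_of_real y)) \<le> (2 + R) * min 1 y"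
      proof (cases "y \<le> 1")
        case True
        have "norm (1 - exp (- Z n * complex_of_real y)) \<le> norm (Z n) * y"
          using norm_one_minus_exp_le[of "Z n * of_real y"] Z y by (simp add: norm_mult)
        also have "\<dots> \<le> (2 + R) * y"
          using R(2)[of n] y by (intro mult_right_mono) auto
        finally show ?thesis using True by simp
      next
        case False
        have "norm (1 - exp (- Z n * complex_of_real y)) \<le> 1 + norm (exp (- Z n * complex_of_real y))"
          using norm_triangle_ineq4[of 1 "exp (- Z n * complex_of_real y)"] by simp
        also have "\<dots> \<le> 1 + 1" using Z y by (intro add_mono) auto
        finally show ?thesis using False R(1) by simp
      qed
    qed
  qed (intro measurable_\<mu>, measurable)+
  then have "(\<lambda>n. of_real q + of_real d * Z n + (\<integral>y. (1 - exp (- Z n * of_real y)) \<partial>\<mu>)) \<longlonglongrightarrow>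
      of_real q + of_real d * z + (\<integral>y. (1 - exp (- z * of_real y)) \<partial>\<mu>)"
    using Z by (intro tendsto_intros) auto
  then show "(\<phi> \<circ> Z) \<longlonglongrightarrow> \<phi> z"
    using Z z by (simp add: o_def \<phi>_eq)
qed

text \<open>The derivative \<open>\<phi>'(x) = d + \<integral> y e\<^sup>-\<^sup>x\<^sup>y \<mu>(dy)\<close> increases as \<open>x\<close> decreases to \<open>0\<close>. If it does not tend
  to infinity, it is therefore bounded, and monotone convergence bounds the first moment.\<close>

lemma integrable_first_moment:
  assumes "\<not> deriv_at_0_infinite \<phi>"
  shows "integrable \<mu> (\<lambda>y. y)"
proof -
  define F where "F x = (\<integral>y. y * exp (- x * y) \<partial>\<mu>)" for x :: real
  have int: "integrable \<mu> (\<lambda>y. y * exp (- x * y))" if "0 < x" for x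
  proof -
    have "complex_integrable \<mu> (\<lambda>y. of_real (y ^ Suc 0) * exp (- of_real x * of_real y))"
      by (rule moment_integrable[of 0]) (use that in \<open>auto intro: exp_moment_nonneg\<close>)
    moreover have "of_real (y ^ Suc 0) * exp (- of_real x * of_real y) = complex_of_real (y * exp (- x * y))" for y
      by (simp add: exp_of_real[symmetric])
    ultimately show ?thesis by (simp only: complex_of_real_integrable_eq)
  qed
  have deriv: "Re (deriv \<phi> (of_real x)) = d + F x" if "0 < x" for x
    using that DERIV_imp_deriv[OF \<phi>_derivative, of "of_real x"] moment_of_real[of 1 x]
    by (simp add: F_def)
  have anti: "F x' \<le> F x" if "0 < x" "x \<le> x'" for x x'
    unfolding F_def using that
    by (intro integral_mono int) (auto simp: space_\<mu> intro!: mult_left_mono mult_right_mono)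
  obtain K where K: "\<exists>\<^sub>F x in at_right 0. \<not> K \<le> Re (deriv \<phi> (of_real x))"
    using assms by (auto simp: deriv_at_0_infinite_def filterlim_at_top frequently_def)
  have bound: "F x \<le> K - d" if "0 < x" for x
  proof -
    have "\<exists>\<^sub>F y in at_right 0. \<not> K \<le> Re (deriv \<phi> (of_real y)) \<and> y \<in> {0<..<x}"
      by (rule frequently_rev_mp[OF K], use eventually_at_right_real[OF that] in eventually_elim) simp
    then obtain y where "\<not> K \<le> Re (deriv \<phi> (of_real y))" "0 < y" "y < x"
      using frequently_ex by force
    then show ?thesis using deriv[of y] anti[of y x] by simp
  qed
  define e where "e n = inverse (real (Suc n))" for n
  have e: "0 < e n" "e (Suc n) \<le> e n" for n by (auto simp: e_def)
  have "incseq (\<lambda>n. F (e n))"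
    by (rule incseq_SucI) (use anti e in auto)
  then obtain L where L: "(\<lambda>n. F (e n)) \<longlonglongrightarrow> L"
    by (rule incseq_convergent[of _ "K - d"]) (use bound e in auto)
  show ?thesis
  proof (rule integrable_monotone_convergence[where f = "\<lambda>n y. y * exp (- e n * y)" and x = L])
    show "integrable \<mu> (\<lambda>y. y * exp (- e n * y))" for n by (rule int[OF e(1)])
    show "AE y in \<mu>. mono (\<lambda>n. y * exp (- e n * y))"
    proof (rule AE_I2)
      fix y assume "y \<in> space \<mu>"
      then have "0 < y" by (simp add: space_\<mu>)
      then show "mono (\<lambda>n. y * exp (- e n * y))"
        using e(2) by (intro incseq_SucI) auto
    qed
    have "e \<longlonglongrightarrow> 0" unfolding e_def by (rule LIMSEQ_inverse_real_of_nat)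
    then have "(\<lambda>n. y * exp (- e n * y)) \<longlonglongrightarrow> y * exp (- 0 * y)" for y
      by (intro tendsto_intros)
    then show "AE y in \<mu>. (\<lambda>n. y * exp (- e n * y)) \<longlonglongrightarrow> y" by simp
    show "(\<lambda>n. \<integral>y. y * exp (- e n * y) \<partial>\<mu>) \<longlonglongrightarrow> L" using L by (simp only: F_def)
  qed (intro measurable_\<mu>, measurable)
qed

text \<open>The quotient is \<open>d + \<integral> (1 - e\<^sup>-\<^sup>z\<^sup>y) / z \<mu>(dy)\<close> with integrand dominated by \<open>y\<close>.
  Its continuous extension to \<open>z = 0\<close> is what removes the pole of \<open>\<Gamma>\<close> at \<open>0\<close> from \<open>M\<close>.\<close>

lemma \<phi>_divided_by_z:
  assumes "\<not> deriv_at_0_infinite \<phi>" "\<phi> 0 = 0"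
  obtains F where "continuous_on {z. 0 \<le> Re z} F" "\<And>z. 0 \<le> Re z \<Longrightarrow> \<phi> z = z * F z"
proof -
  have q0: "q = 0" using assms(2) by (simp add: \<phi>_0)
  define \<kappa> where "\<kappa> y z = (if z = 0 then of_real y else (1 - exp (- z * of_real y)) / z)"
    for y :: real and z :: complex
  have \<kappa>_cont: "isCont (\<kappa> y) z" for y z
  proof (cases "z = 0")
    case True
    have "((\<lambda>w. - exp (- w * of_real y)) has_field_derivative of_real y) (at (0::complex))"
      by (auto intro!: derivative_eq_intros)
    then have "(\<lambda>w. (1 - exp (- w * of_real y)) / w) \<midarrow>0\<rightarrow> complex_of_real y"
      by (simp add: DERIV_def)
    moreover have "\<forall>\<^sub>F w in at 0. (1 - exp (- w * of_real y)) / w = \<kappa> y w"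
      by (auto simp: eventually_at_filter \<kappa>_def)
    ultimately have "\<kappa> y \<midarrow>0\<rightarrow> of_real y" using tendsto_cong by fastforce
    then show ?thesis using True by (simp add: isCont_def \<kappa>_def)
  next
    case False
    have "isCont (\<lambda>w. (1 - exp (- w * of_real y)) / w) z"
      using False by (intro continuous_intros)
    moreover have "\<forall>\<^sub>F w in nhds z. (1 - exp (- w * of_real y)) / w = \<kappa> y w"
      using t1_space_nhds[OF False] by eventually_elim (simp add: \<kappa>_def)
    ultimately show ?thesis using isCont_cong by fastforce
  qed
  define F where "F z = of_real d + (\<integral>y. \<kappa> y z \<partial>\<mu>)" for z
  have "continuous_on {z. 0 \<le> Re z} F"
    unfolding continuous_on_sequentially
  proof (intro allI ballI impI)
    fix Z :: "nat \<Rightarrow> complex" and z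
    assume z: "z \<in> {z. 0 \<le> Re z}" and Z: "(\<forall>n. Z n \<in> {z. 0 \<le> Re z}) \<and> Z \<longlonglongrightarrow> z"
    have "(\<lambda>n. \<integral>y. \<kappa> y (Z n) \<partial>\<mu>) \<longlonglongrightarrow> (\<integral>y. \<kappa> y z \<partial>\<mu>)"
    proof (rule integral_dominated_convergence)
      show "integrable \<mu> (\<lambda>y. y)" by (rule integrable_first_moment[OF assms(1)])
      show "AE y in \<mu>. (\<lambda>n. \<kappa> y (Z n)) \<longlonglongrightarrow> \<kappa> y z"
        using Z by (intro AE_I2 isCont_tendsto_compose[OF \<kappa>_cont]) auto
      show "AE y in \<mu>. norm (\<kappa> y (Z n)) \<le> y" for n
      proof (rule AE_I2)
        fix y assume "y \<in> space \<mu>"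
        then have y: "0 < y" by (simp add: space_\<mu>)
        then show "norm (\<kappa> y (Z n)) \<le> y"
          using norm_one_minus_exp_le[of "Z n * of_real y"] Z
          by (simp add: \<kappa>_def norm_divide norm_mult field_simps)
      qed
      show "(\<lambda>y. \<kappa> y z) \<in> borel_measurable \<mu>" for z
        by (cases "z = 0") (simp_all add: \<kappa>_def measurable_\<mu>)
      then show "(\<lambda>y. \<kappa> y (Z n)) \<in> borel_measurable \<mu>" for n by this
    qed
    then show "(F \<circ> Z) \<longlonglongrightarrow> F z"
      unfolding F_def o_def by (intro tendsto_intros)
  qed
  moreover have "\<phi> z = z * F z" if "0 \<le> Re z" for z
  proof (cases "z = 0")
    case True
    then show ?thesis using assms(2) by simp
  next
    case False
    then show ?thesis using that q0 by (simp add: F_def \<phi>_eq \<kappa>_def algebra_simps)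
  qed
  ultimately show ?thesis by (rule that)
qed

end

section \<open>Poles of the Gamma function times an analytic function\<close>

text \<open>Since \<open>\<Gamma>(w) = \<Gamma>(w + n + 1) / (w (w + 1) \<dots> (w + n))\<close>, the factor \<open>w + n\<close> can be split off
  explicitly. What remains is holomorphic at \<open>- n\<close>, so order, residue and removability of the
  singularity of \<open>\<Gamma> G\<close> can all be read off from \<open>R\<close>.\<close>

lemma Gamma_mult_analytic_at_pole:
  assumes "G analytic_on {- of_nat n}"
  obtains R S where "open S" "- of_nat n \<in> S" "R holomorphic_on S"
    "R (- of_nat n) = (- 1) ^ n / fact n * G (- of_nat n)"
    "\<And>w. w \<in> S \<Longrightarrow> w \<noteq> - of_nat n \<Longrightarrow> Gamma w * G w = R w / (w - (- of_nat n))"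
proof -
  obtain T where T: "open T" "- of_nat n \<in> T" "G holomorphic_on T"
    using assms by (auto simp: analytic_at)
  \<comment> \<open>in a disc of radius \<open>1\<close> the only pole of \<open>\<Gamma>\<close> is the centre\<close>
  define S where "S = T \<inter> ball (- of_nat n) 1"
  define R where "R w = Gamma (w + of_nat (Suc n)) / pochhammer w n * G w" for w
  have near: "dist w (- of_nat n) < 1" if "w \<in> S" for w
    using that by (simp add: S_def dist_commute)
  have not_int: "w \<notin> \<int>\<^sub>\<le>\<^sub>0" if "w \<in> S" "w \<noteq> - of_nat n" for w
  proof
    assume "w \<in> \<int>\<^sub>\<le>\<^sub>0"
    then obtain m where m: "w = - of_nat m" by (auto elim: nonpos_Ints_cases')
    have "norm (complex_of_real (real n - real m)) < 1"
      using near[OF that(1)] by (simp add: m dist_norm)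
    then have "\<bar>real n - real m\<bar> < 1" by (simp only: norm_of_real)
    then have "n = m" by linarith
    then show False using that m by simp
  qed
  have Re_pos: "0 < Re (w + of_nat (Suc n))" if "w \<in> S" for w
    using near[OF that] abs_Re_le_cmod[of "w - (- of_nat n)"] by (simp add: dist_norm)
  have poch: "pochhammer w n \<noteq> 0" if "w \<in> S" for w
  proof
    assume "pochhammer w n = 0"
    then obtain k where k: "k < n" "w = - of_nat k" by (auto simp: pochhammer_eq_0_iff)
    then show False using not_int[OF that] k by (cases "w = - of_nat n") auto
  qed
  show ?thesis
  proof (rule that[of S R])
    show "open S" "- of_nat n \<in> S" using T by (auto simp: S_def)
    have "w + of_nat (Suc n) \<notin> \<int>\<^sub>\<le>\<^sub>0" if "w \<in> S" for w
    proof
      assume "w + of_nat (Suc n) \<in> \<int>\<^sub>\<le>\<^sub>0"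
      then obtain m where "w + of_nat (Suc n) = - of_nat m" by (rule nonpos_Ints_cases')
      then have "Re (w + of_nat (Suc n)) = - real m" by simp
      then show False using Re_pos[OF that] by simp
    qed
    then have Gam: "(\<lambda>w. Gamma (w + of_nat (Suc n))) holomorphic_on S"
      by (intro holomorphic_intros) auto
    have "(\<lambda>w. pochhammer w n) holomorphic_on S"
      unfolding pochhammer_prod by (intro holomorphic_intros)
    moreover have "G holomorphic_on S"
      by (rule holomorphic_on_subset[OF T(3)]) (simp add: S_def)
    ultimately show "R holomorphic_on S"
      unfolding R_def by (intro holomorphic_on_mult holomorphic_on_divide Gam poch)
    show "R (- of_nat n) = (- 1) ^ n / fact n * G (- of_nat n)"
      by (simp add: R_def pochhammer_same field_simps flip: power_mult_distrib)
    fix w assume w: "w \<in> S" "w \<noteq> - of_nat n"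
    have "pochhammer w (Suc n) = Gamma (w + of_nat (Suc n)) / Gamma w"
      by (rule pochhammer_Gamma[OF not_int[OF w]])
    moreover have "Gamma w \<noteq> 0" using not_int[OF w] by (simp add: Gamma_eq_zero_iff)
    moreover have "w - (- of_nat n) \<noteq> 0" using w(2) by (simp only: right_minus_eq not_False_eq_True)
    ultimately have "Gamma (w + of_nat (Suc n)) = Gamma w * (pochhammer w n * (w - (- of_nat n)))"
      by (simp add: pochhammer_Suc field_simps)
    then show "Gamma w * G w = R w / (w - (- of_nat n))"
      using poch[OF w(1)] \<open>w - (- of_nat n) \<noteq> 0\<close> by (simp add: R_def)
  qed
qed

section \<open>Rescaling a Bernstein function\<close>

lemma is_hol_extension_scale:
  assumes "is_hol_extension \<phi> u g"
  shows "is_hol_extension (\<lambda>w. c * \<phi> w) u (\<lambda>w. c * g w)"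
  using assms by (auto simp: is_hol_extension_def intro!: holomorphic_intros)

lemma abscissa_scale:
  assumes "c \<noteq> 0"
  shows "abscissa (\<lambda>w. c * \<phi> w) = abscissa \<phi>"
proof -
  have "(\<exists>g. is_hol_extension (\<lambda>w. c * \<phi> w) u g) \<longleftrightarrow> (\<exists>g. is_hol_extension \<phi> u g)" for u
    using is_hol_extension_scale[of \<phi> u _ c] is_hol_extension_scale[of "\<lambda>w. c * \<phi> w" u _ "inverse c"] assms
    by (auto simp flip: mult.assoc)
  then show ?thesis by (simp add: abscissa_def)
qed

context bernstein_rep
begin

context
  fixes c :: real
  assumes c: "0 < c"
begin

abbreviation scaled :: "complex \<Rightarrow> complex" where
  "scaled \<equiv> (\<lambda>w. of_real c * \<phi> w)"

lemma bext_scale: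
  assumes "abscissa \<phi> < ereal (Re z) \<or> 0 \<le> Re z"
  shows "bext scaled z = of_real c * bext \<phi> z"
proof (rule hol_extension_unique[of scaled "abscissa \<phi>" _ "\<lambda>w. of_real c * bext \<phi> w"])
  show ext: "is_hol_extension scaled (abscissa \<phi>) (\<lambda>w. of_real c * bext \<phi> w)"
    by (rule is_hol_extension_scale[OF bext_is_extension])
  have "abscissa scaled = abscissa \<phi>" using c by (intro abscissa_scale) simp
  then show "is_hol_extension scaled (abscissa \<phi>) (bext scaled)"
    unfolding bext_def[of scaled] using ext by (simp add: someI)
qed (use assms abscissa_le_0 in auto)

lemma deriv_scaled: "0 < Re z \<Longrightarrow> deriv scaled z = of_real c * deriv \<phi> z"
  using \<phi>_derivative by (intro deriv_cmult) (auto simp: field_differentiable_def)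

lemma log_deriv_scaled: "0 < Re z \<Longrightarrow> deriv scaled z / scaled z = deriv \<phi> z / \<phi> z"
  using c by (simp add: deriv_scaled)

text \<open>Logarithmic derivatives do not see the constant; only \<open>ln \<phi>(n)\<close> does.\<close>

lemma gamma_const_scale: "gamma_const scaled = gamma_const \<phi> - ln c"
proof -
  let ?g = "\<lambda>\<phi> n. (\<Sum>k=1..n. Re (deriv \<phi> (of_nat k) / \<phi> (of_nat k))) - ln (Re (\<phi> (of_nat n)))"
  have "\<forall>\<^sub>F n in sequentially. ?g scaled n = ?g \<phi> n - ln c"
    using eventually_gt_at_top[of 0]
  proof eventually_elim
    case (elim n)
    have "(\<Sum>k=1..n. Re (deriv scaled (of_nat k) / scaled (of_nat k)))
        = (\<Sum>k=1..n. Re (deriv \<phi> (of_nat k) / \<phi> (of_nat k)))"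
      by (intro sum.cong refl arg_cong[of _ _ Re] log_deriv_scaled) auto
    moreover have "0 < Re (\<phi> (of_nat n))" using elim by (intro Re_\<phi>_pos) simp
    ultimately show ?case using c by (simp add: ln_mult)
  qed
  moreover have "(\<lambda>n. ?g \<phi> n - ln c) \<longlonglongrightarrow> gamma_const \<phi> - ln c"
    using gamma_tendsto by (intro tendsto_intros) (simp add: gamma_const_def limI)
  ultimately have "?g scaled \<longlonglongrightarrow> gamma_const \<phi> - ln c"
    using tendsto_cong by fastforce
  then show ?thesis unfolding gamma_const_def[of scaled] by (rule limI)
qed

lemma bg_W_half_scale: "bg_W_half scaled z = exp (of_real (ln c) * (z - 1)) * bg_W_half \<phi> z"
proof -
  have "scaled (of_nat (Suc k)) / scaled (of_nat (Suc k) + z)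
        * exp (deriv scaled (of_nat (Suc k)) / scaled (of_nat (Suc k)) * z)
      = \<phi> (of_nat (Suc k)) / \<phi> (of_nat (Suc k) + z)
        * exp (deriv \<phi> (of_nat (Suc k)) / \<phi> (of_nat (Suc k)) * z)" for k
    using c log_deriv_scaled[of "of_nat (Suc k)"] by simp
  moreover have "exp (- of_real (gamma_const scaled) * z)
      = exp (of_real (ln c) * (z - 1)) * of_real c * exp (- of_real (gamma_const \<phi>) * z)"
  proof -
    have "exp (- of_real (gamma_const scaled) * z)
        = exp (of_real (ln c) * (z - 1)) * exp (of_real (ln c)) * exp (- of_real (gamma_const \<phi>) * z)"
      unfolding gamma_const_scale by (simp add: algebra_simps flip: exp_add)
    moreover have "exp (of_real (ln c)) = complex_of_real c" using c by (simp add: exp_of_real)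
    ultimately show ?thesis by (simp only:)
  qed
  ultimately show ?thesis using c by (simp only: bg_W_half_def) simp
qed

lemma bg_W_scale:
  assumes "abscissa \<phi> < ereal (Re z)"
  shows "bg_W scaled z = exp (of_real (ln c) * (z - 1)) * bg_W \<phi> z"
proof -
  define n where "n = nat (\<lfloor>- Re z\<rfloor> + 1)"
  have "bext scaled (z + of_nat k) = of_real c * bext \<phi> (z + of_nat k)" for k
    using less_le_trans[OF assms, of "ereal (Re z + real k)"] by (intro bext_scale) simp
  then have prod: "(\<Prod>k<n. bext scaled (z + of_nat k)) = of_real c ^ n * (\<Prod>k<n. bext \<phi> (z + of_nat k))"
    by (simp add: prod.distrib)
  have "complex_of_real c ^ n = exp (of_nat n * of_real (ln c))"
    using c by (simp add: exp_of_nat_mult exp_of_real)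
  then have "exp (of_real (ln c) * (z + of_nat n - 1)) = exp (of_real (ln c) * (z - 1)) * complex_of_real c ^ n"
    by (simp add: algebra_simps flip: exp_add)
  then show ?thesis
    using c by (simp add: bg_W_def Let_def prod bg_W_half_scale flip: n_def)
qed

end
end

section \<open>Meromorphy and poles\<close>

lemma less_one_minus_iff: "ereal x < 1 - a \<longleftrightarrow> a < ereal (1 - x)"
  by (cases a) (auto simp: one_ereal_def)

locale bernstein_pair = p: bernstein_rep \<phi>p qp dp \<mu>p + m: bernstein_rep \<phi>m qm dm \<mu>m
  for \<phi>p qp dp \<mu>p \<phi>m qm dm \<mu>m
begin

abbreviation strip :: "complex set" where
  "strip \<equiv> vstrip (abscissa \<phi>p) (1 - abscissa \<phi>m)"

abbreviation M :: "complex \<Rightarrow> complex" where "M \<equiv> M_Psi \<phi>p \<phi>m"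

text \<open>What is left of \<open>M\<close> when \<open>\<Gamma>\<close> is split off: it is holomorphic at those poles of \<open>\<Gamma>\<close> that lie in
  the strip.\<close>

definition Gamma_cofactor :: "complex \<Rightarrow> complex" where
  "Gamma_cofactor z = inverse (bg_W \<phi>p z) * bg_W \<phi>m (1 - z)"

lemma M_raw_eq: "M_raw \<phi>p \<phi>m z = Gamma z * Gamma_cofactor z"
  by (simp add: M_raw_def Gamma_cofactor_def divide_inverse mult.assoc)

lemma in_vstrip_iff: "z \<in> vstrip a (1 - b) \<longleftrightarrow> a < ereal (Re z) \<and> b < ereal (1 - Re z)"
  by (simp add: vstrip_def less_one_minus_iff)

lemma Gamma_cofactor_analytic:
  assumes "abscissa \<phi>p < ereal (Re z)" "bg_W \<phi>m analytic_on {1 - z}"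
  shows "Gamma_cofactor analytic_on {z}"
proof -
  have "(bg_W \<phi>m \<circ> (\<lambda>w. 1 - w)) analytic_on {z}"
    by (rule analytic_on_compose) (use assms(2) in \<open>auto intro: analytic_intros\<close>)
  then have "(\<lambda>w. bg_W \<phi>m (1 - w)) analytic_on {z}" by (simp only: o_def)
  then show ?thesis
    unfolding Gamma_cofactor_def[abs_def]
    by (intro analytic_on_mult p.inverse_bg_W_analytic assms)
qed

lemma Gamma_cofactor_analytic_right:
  "abscissa \<phi>p < ereal (Re z) \<Longrightarrow> abar \<phi>m < ereal (1 - Re z) \<Longrightarrow> Gamma_cofactor analytic_on {z}"
  by (intro Gamma_cofactor_analytic m.bg_W_analytic_above_abar) simp_all

lemma M_raw_analytic:
  assumes "Gamma_cofactor analytic_on {z}" "z \<notin> \<int>\<^sub>\<le>\<^sub>0"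
  shows "M_raw \<phi>p \<phi>m analytic_on {z}"
  unfolding M_raw_eq[abs_def] by (intro analytic_on_mult analytic_Gamma assms) (use assms in auto)

text \<open>All three factors are reciprocals of holomorphic functions, or holomorphic: \<open>1 / \<Gamma>\<close> is entire, and
  the reciprocals of the two Bernstein-gamma functions are holomorphic to the right of the abscissae.\<close>

lemma M_raw_meromorphic: "M_raw \<phi>p \<phi>m meromorphic_on strip"
proof -
  have "(\<lambda>w. inverse (rGamma w)) meromorphic_on strip"
    by (intro meromorphic_on_inverse analytic_on_imp_meromorphic_on analytic_rGamma)
  then have Gam: "Gamma meromorphic_on strip"
    by (simp add: rGamma_inverse_Gamma)
  have "(\<lambda>w. inverse (bg_W \<phi>p w)) analytic_on strip"
    by (subst analytic_on_analytic_at) (auto simp: vstrip_def intro: p.inverse_bg_W_analytic)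
  then have invp: "(\<lambda>w. inverse (bg_W \<phi>p w)) meromorphic_on strip"
    by (rule analytic_on_imp_meromorphic_on)
  have "(\<lambda>w. inverse (bg_W \<phi>m (1 - w))) analytic_on strip"
  proof (subst analytic_on_analytic_at, rule ballI)
    fix z assume "z \<in> strip"
    then have "abscissa \<phi>m < ereal (Re (1 - z))" by (simp add: in_vstrip_iff)
    then have "((\<lambda>w. inverse (bg_W \<phi>m w)) \<circ> (\<lambda>w. 1 - w)) analytic_on {z}"
      by (intro analytic_on_compose) (auto intro: analytic_intros m.inverse_bg_W_analytic)
    then show "(\<lambda>w. inverse (bg_W \<phi>m (1 - w))) analytic_on {z}" by (simp only: o_def)
  qed
  then have "(\<lambda>w. inverse (inverse (bg_W \<phi>m (1 - w)))) meromorphic_on strip"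
    by (intro meromorphic_on_inverse analytic_on_imp_meromorphic_on)
  then have "(\<lambda>w. bg_W \<phi>m (1 - w)) meromorphic_on strip" by simp
  with Gam invp show ?thesis
    unfolding M_raw_eq[abs_def] Gamma_cofactor_def by (intro meromorphic_on_mult)
qed

lemma M_eq_remove_sings: "z \<in> strip \<Longrightarrow> \<forall>\<^sub>F w in nhds z. M w = remove_sings (M_raw \<phi>p \<phi>m) w"
  using eventually_nhds_in_open[OF open_vstrip, of z "abscissa \<phi>p" "1 - abscissa \<phi>m"]
  by (auto elim!: eventually_mono simp: M_Psi_def)

lemma M_eventually_eq_raw:
  assumes "z \<in> strip"
  shows "\<forall>\<^sub>F w in at z. M w = M_raw \<phi>p \<phi>m w"
proof -
  have "\<forall>\<^sub>F w in at z. remove_sings (M_raw \<phi>p \<phi>m) w = M_raw \<phi>p \<phi>m w"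
    using assms M_raw_meromorphic
    by (intro eventually_remove_sings_eq_at meromorphic_on_isolated_singularity)
       (auto intro: meromorphic_on_subset)
  moreover have "\<forall>\<^sub>F w in at z. M w = remove_sings (M_raw \<phi>p \<phi>m) w"
    using M_eq_remove_sings[OF assms] by (simp add: eventually_nhds_conv_at)
  ultimately show ?thesis by eventually_elim simp
qed

lemma M_meromorphic: "M meromorphic_on strip"
proof -
  have "remove_sings (M_raw \<phi>p \<phi>m) meromorphic_on strip"
    by (rule remove_sings_meromorphic[OF M_raw_meromorphic])
  moreover have "M meromorphic_on strip \<longleftrightarrow> remove_sings (M_raw \<phi>p \<phi>m) meromorphic_on strip"
    using M_eq_remove_sings
    by (intro meromorphic_on_cong refl) (auto simp: eventually_nhds_conv_at)
  ultimately show ?thesis by blast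
qed

lemma M_analytic_if_no_pole:
  assumes "z \<in> strip" "\<not> is_pole M z"
  shows "M analytic_on {z}"
proof -
  have "\<not> is_pole (remove_sings (M_raw \<phi>p \<phi>m)) z"
    using assms M_eq_remove_sings[OF assms(1)] is_pole_cong[of M "remove_sings (M_raw \<phi>p \<phi>m)" z z]
    by (auto simp: eventually_nhds_conv_at)
  then have "remove_sings (M_raw \<phi>p \<phi>m) analytic_on {z}"
    by (intro nicely_meromorphic_on_imp_analytic_at[OF remove_sings_nicely_meromorphic[OF M_raw_meromorphic] assms(1)])
  then show ?thesis
    using analytic_at_cong[OF M_eq_remove_sings[OF assms(1)] refl] by blast
qed

lemma M_eq_raw:
  assumes "z \<in> strip \<Longrightarrow> M_raw \<phi>p \<phi>m analytic_on {z}"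
  shows "M z = M_raw \<phi>p \<phi>m z"
  using assms by (simp add: M_Psi_def)

lemma M_no_pole_off_Gamma_poles:
  assumes "abscissa \<phi>p < ereal (Re z)" "abar \<phi>m < ereal (1 - Re z)" "z \<notin> \<int>\<^sub>\<le>\<^sub>0"
  shows "\<not> is_pole M z"
proof -
  have "z \<in> strip" using assms m.abscissa_le_abar by (auto simp: in_vstrip_iff intro: le_less_trans)
  moreover have "\<not> is_pole (M_raw \<phi>p \<phi>m) z"
    by (intro analytic_at_imp_no_pole M_raw_analytic Gamma_cofactor_analytic_right assms)
  ultimately show ?thesis using is_pole_cong[OF M_eventually_eq_raw refl] by blast
qed

context
  fixes n :: nat
  assumes n: "abscissa \<phi>p < ereal (- real n)"
begin

lemma minus_nat_in_strip: "- of_nat n \<in> strip"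
  using n m.abscissa_le_0 by (auto simp: in_vstrip_iff zero_ereal_def intro: le_less_trans)

lemma Gamma_cofactor_minus_nat:
  "Gamma_cofactor (- of_nat n) = (\<Prod>k\<le>n. bext \<phi>p (- of_nat k)) * (\<Prod>k=1..n. \<phi>m (of_nat k))"
  using m.bg_W_Suc[of n] by (simp add: Gamma_cofactor_def p.inverse_bg_W_minus_nat add_ac)

text \<open>The values of \<open>\<phi>m\<close> at positive integers do not vanish, and \<open>largest_zero \<phi>p\<close> is the only real zero
  of \<open>\<phi>p\<close> that can occur.\<close>

lemma Gamma_cofactor_minus_nat_eq_0_iff:
  "Gamma_cofactor (- of_nat n) = 0 \<longleftrightarrow> (\<exists>k\<le>n. largest_zero \<phi>p = ereal (- real k))"
proof -
  have "(\<Prod>k=1..n. \<phi>m (of_nat k)) \<noteq> 0"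
    using m.\<phi>_nonzero by (auto simp: prod_zero_iff)
  moreover have "bext \<phi>p (- of_nat k) = 0 \<longleftrightarrow> largest_zero \<phi>p = ereal (- real k)" if "k \<le> n" for k
  proof -
    have "abscissa \<phi>p < ereal (- real k)" using n by (rule less_le_trans) (use that in simp)
    then show ?thesis using p.bext_real_zero_iff[of "- real k"] by simp
  qed
  ultimately show ?thesis by (auto simp: Gamma_cofactor_minus_nat prod_zero_iff)
qed

lemma M_at_minus_nat:
  "residue M (- of_nat n) = (- 1) ^ n / fact n * Gamma_cofactor (- of_nat n)"
  "Gamma_cofactor (- of_nat n) \<noteq> 0 \<Longrightarrow> is_pole M (- of_nat n)"
  "Gamma_cofactor (- of_nat n) \<noteq> 0 \<Longrightarrow> zorder M (- of_nat n) = - 1"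
  "Gamma_cofactor (- of_nat n) = 0 \<Longrightarrow> \<not> is_pole M (- of_nat n)"
proof -
  let ?z = "- of_nat n :: complex"
  have "abar \<phi>m < ereal (1 - Re ?z)"
    using m.abar_le_0 by (rule le_less_trans) (simp add: zero_ereal_def)
  then have "Gamma_cofactor analytic_on {?z}" using n by (intro Gamma_cofactor_analytic_right) simp_all
  then obtain R T where T: "open T" "?z \<in> T" and R: "R holomorphic_on T"
      and R0: "R ?z = (- 1) ^ n / fact n * Gamma_cofactor ?z"
      and eq: "\<And>w. w \<in> T \<Longrightarrow> w \<noteq> ?z \<Longrightarrow> Gamma w * Gamma_cofactor w = R w / (w - ?z)"
    using Gamma_mult_analytic_at_pole by metis
  have ev: "\<forall>\<^sub>F w in at ?z. M w = R w / (w - ?z)"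
    using M_eventually_eq_raw[OF minus_nat_in_strip] eventually_at_in_open[OF T]
  proof eventually_elim
    case (elim w)
    then have "Gamma w * Gamma_cofactor w = R w / (w - ?z)" by (intro eq) blast+
    then show ?case using elim(1) by (simp only: M_raw_eq)
  qed
  show "residue M ?z = (- 1) ^ n / fact n * Gamma_cofactor ?z"
    using residue_cong[OF ev refl] residue_simple[OF T R] R0 by simp
  {
    assume "Gamma_cofactor ?z \<noteq> 0"
    then have nz: "R ?z \<noteq> 0" by (simp add: R0)
    have "is_pole (\<lambda>w. R w / (w - ?z) ^ 1) ?z"
      by (rule is_pole_basic[OF R T nz]) simp
    then show "is_pole M ?z" using is_pole_cong[OF ev refl] by simp
    have "zorder (\<lambda>w. R w / (w - ?z) ^ 1) ?z = - int 1"
      by (rule zorder_nonzero_div_power[OF T R nz]) simp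
    then show "zorder M ?z = - 1" using zorder_cong[OF ev refl] by simp
  }
  assume "Gamma_cofactor ?z = 0"
  then have "R ?z = 0" by (simp add: R0)
  have "(R has_field_derivative deriv R ?z) (at ?z)"
    by (rule holomorphic_derivI[OF R T])
  then have "(\<lambda>w. R w / (w - ?z)) \<midarrow>?z\<rightarrow> deriv R ?z"
    using \<open>R ?z = 0\<close> by (simp add: has_field_derivative_iff)
  then have "M \<midarrow>?z\<rightarrow> deriv R ?z" using tendsto_cong[OF ev] by blast
  then show "\<not> is_pole M ?z"
    by (auto simp: is_pole_def dest: not_tendsto_and_filterlim_at_infinity[rotated])
qed

end

end

section \<open>The recurrence and continuity up to the imaginary axis\<close>

lemma remove_sings_cmult:
  assumes "not_essential f z" "c \<noteq> 0"
  shows "remove_sings (\<lambda>w. c * f w) z = c * remove_sings f z"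
proof (cases "is_pole f z")
  case True
  then have "is_pole (\<lambda>w. c * f w) z"
    by (intro is_pole_mult_analytic_nonzero1) (use assms in auto)
  then show ?thesis using True by simp
next
  case False
  then obtain L where L: "f \<midarrow>z\<rightarrow> L" using assms(1) by (auto simp: not_essential_def)
  then have "(\<lambda>w. c * f w) \<midarrow>z\<rightarrow> c * L" by (intro tendsto_intros)
  then show ?thesis using L by (auto dest!: remove_sings_eqI)
qed

context bernstein_pair
begin

lemma not_nonpos_Int: "0 \<le> Re z \<Longrightarrow> z \<noteq> 0 \<Longrightarrow> z \<notin> \<int>\<^sub>\<le>\<^sub>0"
  by (auto elim!: nonpos_Ints_cases')

text \<open>The two functional equations of \<open>W\<close> and that of \<open>\<Gamma>\<close> give this for the defining formula. At both
  \<open>z\<close> and \<open>z + 1\<close> the formula is either used directly or analytic, so that removing singularities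
  does not change its value.\<close>

lemma M_recurrence:
  assumes z: "Re z = 0" "z \<noteq> 0" and nz: "\<phi>p z \<noteq> 0" "\<phi>m (- z) \<noteq> 0"
  shows "M (z + 1) = z / (\<phi>p z * \<phi>m (- z)) * M z"
proof -
  have z_int: "z \<notin> \<int>\<^sub>\<le>\<^sub>0" using z by (intro not_nonpos_Int) auto
  have Wp: "bg_W \<phi>p z = bg_W_half \<phi>p (z + 1) / \<phi>p z" "bg_W \<phi>p (z + 1) = bg_W_half \<phi>p (z + 1)"
    using p.bg_W_eq[of z 1] p.bg_W_eq[of "z + 1" 0] z p.bext_eq_\<phi>[of z] by simp_all
  have Wm: "bg_W \<phi>m (- z) = bg_W_half \<phi>m (1 - z) / \<phi>m (- z)" "bg_W \<phi>m (1 - z) = bg_W_half \<phi>m (1 - z)"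
    using m.bg_W_eq[of "- z" 1] m.bg_W_eq[of "1 - z" 0] z m.bext_eq_\<phi>[of "- z"] by simp_all
  have pos: "bg_W_half \<phi>p (z + 1) \<noteq> 0" "bg_W_half \<phi>m (1 - z) \<noteq> 0"
    using z p.bg_W_half_nonzero[of "z + 1"] m.bg_W_half_nonzero[of "1 - z"] by simp_all
  have M1: "M z = M_raw \<phi>p \<phi>m z"
  proof (rule M_eq_raw)
    assume "z \<in> strip"
    moreover have "abar \<phi>m < ereal (1 - Re z)"
      using m.abar_le_0 z by (auto intro: le_less_trans)
    ultimately show "M_raw \<phi>p \<phi>m analytic_on {z}"
      by (intro M_raw_analytic Gamma_cofactor_analytic_right z_int) (simp_all add: in_vstrip_iff)
  qed
  have M2: "M (z + 1) = M_raw \<phi>p \<phi>m (z + 1)"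
  proof (rule M_eq_raw)
    assume strip: "z + 1 \<in> strip"
    have "bg_W \<phi>m analytic_on {1 - (z + 1)}"
      by (rule m.bg_W_analytic) (use strip pos nz Wm z in \<open>auto simp: in_vstrip_iff\<close>)
    then show "M_raw \<phi>p \<phi>m analytic_on {z + 1}"
      by (intro M_raw_analytic Gamma_cofactor_analytic not_nonpos_Int)
         (use strip z in \<open>auto simp: in_vstrip_iff complex_eq_iff\<close>)
  qed
  have "Gamma (z + 1) = z * Gamma z" by (rule Gamma_plus1[OF z_int])
  then show ?thesis
    using nz pos by (simp add: M1 M2 M_raw_def Wp Wm mult_ac)
qed

lemma a_Psi_le_0: "a_Psi \<phi>p \<le> 0"
  by (simp add: a_Psi_def p.abscissa_le_0)

lemma abscissa_le_a_Psi: "abscissa \<phi>p \<le> a_Psi \<phi>p"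
  by (simp add: a_Psi_def p.abscissa_le_0)

text \<open>The strip meets the poles of \<open>\<Gamma>\<close> only if \<open>a_Psi \<phi>p < 0\<close>. Then \<open>\<phi>p\<close> vanishes at \<open>0\<close>, and this one
  zero cancels every pole, since each \<open>1 / W(- n)\<close> contains the factor \<open>\<phi>p(0)\<close>.\<close>

lemma M_holomorphic: "M holomorphic_on vstrip (a_Psi \<phi>p) (1 - abar \<phi>m)"
proof -
  have "M analytic_on {z}" if z: "z \<in> vstrip (a_Psi \<phi>p) (1 - abar \<phi>m)" for z
  proof (rule M_analytic_if_no_pole)
    have z': "a_Psi \<phi>p < ereal (Re z)" "abar \<phi>m < ereal (1 - Re z)"
      using z by (simp_all add: in_vstrip_iff)
    have ap: "abscissa \<phi>p < ereal (Re z)" by (rule le_less_trans[OF abscissa_le_a_Psi z'(1)])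
    have am: "abscissa \<phi>m < ereal (1 - Re z)" by (rule le_less_trans[OF m.abscissa_le_abar z'(2)])
    show "z \<in> strip" using ap am by (simp add: in_vstrip_iff)
    show "\<not> is_pole M z"
    proof (cases "z \<in> \<int>\<^sub>\<le>\<^sub>0")
      case False
      then show ?thesis by (intro M_no_pole_off_Gamma_poles ap z'(2))
    next
      case True
      then obtain n where n: "z = - of_nat n" by (rule nonpos_Ints_cases')
      have "abscissa \<phi>p < ereal (- real n)" using ap n by simp
      moreover have "abscissa \<phi>p < 0"
        by (rule less_le_trans[OF ap]) (simp add: n)
      moreover have "a_Psi \<phi>p \<noteq> 0"
        using z'(1) n by auto
      ultimately have "abscissa \<phi>p < ereal (- real n)" "largest_zero \<phi>p = ereal (- real 0)"
        by (auto simp: a_Psi_def abar_def max_def split: if_splits)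
      then show ?thesis
        unfolding n by (intro M_at_minus_nat(4)) (auto simp: Gamma_cofactor_minus_nat_eq_0_iff intro!: exI[of _ 0])
    qed
  qed
  then show ?thesis using analytic_on_analytic_at analytic_imp_holomorphic by blast
qed

text \<open>One step of the recurrence moves \<open>1 / W\<^sub>+\<close> off the imaginary axis; the factor \<open>\<phi>p(z)\<close> that this
  produces is kept apart because it is responsible for the behaviour at \<open>0\<close>.\<close>

definition boundary_factor :: "complex \<Rightarrow> complex" where
  "boundary_factor z = inverse (bg_W_half \<phi>p (z + 1)) * bg_W \<phi>m (1 - z)"

lemma boundary_factor_continuous: "continuous_on {z. 0 \<le> Re z \<and> abar \<phi>m < ereal (1 - Re z)} boundary_factor"
proof -
  have "continuous_on {z. 0 \<le> Re z \<and> abar \<phi>m < ereal (1 - Re z)} (\<lambda>z. bg_W_half \<phi>p (z + 1))"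
    by (rule continuous_on_compose2[OF holomorphic_on_imp_continuous_on[OF p.bg_W_half_holomorphic]])
       (auto intro!: continuous_intros)
  moreover have "bg_W \<phi>m holomorphic_on vstrip (abar \<phi>m) \<infinity>"
    by (intro analytic_imp_holomorphic, subst analytic_on_analytic_at)
       (auto simp: vstrip_def intro: m.bg_W_analytic_above_abar)
  then have "continuous_on (vstrip (abar \<phi>m) \<infinity>) (bg_W \<phi>m)"
    by (rule holomorphic_on_imp_continuous_on)
  then have "continuous_on {z. 0 \<le> Re z \<and> abar \<phi>m < ereal (1 - Re z)} (\<lambda>z. bg_W \<phi>m (1 - z))"
    by (rule continuous_on_compose2) (auto intro!: continuous_intros simp: vstrip_def)
  moreover have "bg_W_half \<phi>p (z + 1) \<noteq> 0" if "0 \<le> Re z" for z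
    using that by (intro p.bg_W_half_nonzero) simp
  ultimately show ?thesis
    unfolding boundary_factor_def[abs_def] by (intro continuous_on_mult continuous_on_inverse) auto
qed

lemma M_right_half_plane:
  assumes "0 < Re z" "abar \<phi>m < ereal (1 - Re z)"
  shows "M z = Gamma z * \<phi>p z * boundary_factor z"
proof -
  have "M z = M_raw \<phi>p \<phi>m z"
  proof (rule M_eq_raw, intro M_raw_analytic Gamma_cofactor_analytic_right not_nonpos_Int)
    show "abscissa \<phi>p < ereal (Re z)"
      using p.abscissa_le_0 by (rule le_less_trans) (use assms in simp)
  qed (use assms in auto)
  moreover have "bg_W \<phi>p z = bg_W_half \<phi>p (z + 1) / \<phi>p z"
    using p.bg_W_eq[of z 1] assms p.bext_eq_\<phi>[of z] by simp
  ultimately show ?thesis by (simp add: M_raw_def boundary_factor_def field_simps)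
qed

lemma M_extends_off_0: "extends_continuously M (vstrip 0 (1 - abar \<phi>m)) (iR - {0})"
  unfolding extends_continuously_def
proof (intro exI[of _ "\<lambda>z. Gamma z * \<phi>p z * boundary_factor z"] conjI ballI)
  let ?T = "vstrip 0 (1 - abar \<phi>m) \<union> (iR - {0})"
  have T: "0 \<le> Re z" "z \<noteq> 0" "abar \<phi>m < ereal (1 - Re z)" if "z \<in> ?T" for z
    using that m.abar_le_0
    by (auto simp: in_vstrip_iff vline_def zero_ereal_def intro: le_less_trans)
  have "continuous_on ?T Gamma"
    by (rule continuous_on_Gamma) (use T not_nonpos_Int in blast)
  moreover have "continuous_on ?T \<phi>p"
    by (rule continuous_on_subset[OF p.\<phi>_continuous]) (use T in auto)
  moreover have "continuous_on ?T boundary_factor"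
    by (rule continuous_on_subset[OF boundary_factor_continuous]) (use T in auto)
  ultimately show "continuous_on ?T (\<lambda>z. Gamma z * \<phi>p z * boundary_factor z)"
    by (intro continuous_on_mult)
  fix z assume "z \<in> vstrip 0 (1 - abar \<phi>m)"
  then show "Gamma z * \<phi>p z * boundary_factor z = M z"
    by (intro M_right_half_plane[symmetric]) (auto simp: in_vstrip_iff zero_ereal_def)
qed

text \<open>With \<open>\<phi>p(z) = z F(z)\<close> the product \<open>\<Gamma>(z) \<phi>p(z)\<close> becomes \<open>\<Gamma>(z + 1) F(z)\<close>, which has no singularity
  at \<open>0\<close>.\<close>

lemma M_extends_to_line:
  assumes "\<not> deriv_at_0_infinite \<phi>p" "\<phi>p 0 = 0"
  shows "extends_continuously M (vstrip 0 (1 - abar \<phi>m)) (vline 0)"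
proof -
  obtain F where F: "continuous_on {z. 0 \<le> Re z} F" "\<And>z. 0 \<le> Re z \<Longrightarrow> \<phi>p z = z * F z"
    using p.\<phi>_divided_by_z[OF assms] by blast
  show ?thesis
    unfolding extends_continuously_def
  proof (intro exI[of _ "\<lambda>z. Gamma (z + 1) * F z * boundary_factor z"] conjI ballI)
    let ?T = "vstrip 0 (1 - abar \<phi>m) \<union> vline 0"
    have T: "0 \<le> Re z" "abar \<phi>m < ereal (1 - Re z)" if "z \<in> ?T" for z
      using that m.abar_le_0
      by (auto simp: in_vstrip_iff vline_def zero_ereal_def intro: le_less_trans)
    have "continuous_on ?T (\<lambda>z. Gamma (z + 1))"
    proof (rule continuous_on_compose2[OF continuous_on_Gamma[of "- \<int>\<^sub>\<le>\<^sub>0"]])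
      have "z + 1 \<notin> \<int>\<^sub>\<le>\<^sub>0" if "z \<in> ?T" for z
        using T(1)[OF that] by (intro not_nonpos_Int) (auto simp: complex_eq_iff)
      then show "(\<lambda>z. z + 1) ` ?T \<subseteq> - \<int>\<^sub>\<le>\<^sub>0" by blast
    qed (auto intro: continuous_intros)
    moreover have "continuous_on ?T F"
      by (rule continuous_on_subset[OF F(1)]) (use T in auto)
    moreover have "continuous_on ?T boundary_factor"
      by (rule continuous_on_subset[OF boundary_factor_continuous]) (use T in auto)
    ultimately show "continuous_on ?T (\<lambda>z. Gamma (z + 1) * F z * boundary_factor z)"
      by (intro continuous_on_mult)
    fix z assume "z \<in> vstrip 0 (1 - abar \<phi>m)"
    then have z: "0 < Re z" "abar \<phi>m < ereal (1 - Re z)" by (auto simp: in_vstrip_iff zero_ereal_def)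
    moreover have "Gamma (z + 1) = z * Gamma z"
      using z by (intro Gamma_plus1 not_nonpos_Int) auto
    ultimately show "Gamma (z + 1) * F z * boundary_factor z = M z"
      using M_right_half_plane[of z] F(2)[of z] by simp
  qed
qed

section \<open>Location and residues of the poles\<close>

lemma M_pole_iff:
  assumes z: "z \<in> vstrip (abscissa \<phi>p) (1 - abar \<phi>m)"
  shows "is_pole M z \<longleftrightarrow> (\<exists>n. z = - of_nat n \<and> (\<forall>k\<le>n. largest_zero \<phi>p \<noteq> ereal (- real k)))"
proof (cases "z \<in> \<int>\<^sub>\<le>\<^sub>0")
  case False
  moreover have "\<not> is_pole M z"
    by (rule M_no_pole_off_Gamma_poles) (use z False in \<open>auto simp: in_vstrip_iff\<close>)
  ultimately show ?thesis by auto
next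
  case True
  then obtain n where n: "z = - of_nat n" by (rule nonpos_Ints_cases')
  have "abscissa \<phi>p < ereal (- real n)" using z n by (simp add: in_vstrip_iff)
  from M_at_minus_nat(2,4)[OF this] Gamma_cofactor_minus_nat_eq_0_iff[OF this] show ?thesis
    unfolding n by auto
qed

lemma minus_nat_in_strip_iff:
  "- of_nat n \<in> vstrip (abscissa \<phi>p) (1 - abar \<phi>m) \<longleftrightarrow> abscissa \<phi>p < ereal (- real n)"
  using m.abar_le_0 by (auto simp: in_vstrip_iff zero_ereal_def intro: le_less_trans)

lemma M_simple_pole:
  assumes z: "z \<in> vstrip (abscissa \<phi>p) (1 - abar \<phi>m)" and "is_pole M z"
  shows "zorder M z = - 1"
proof -
  obtain n where n: "z = - of_nat n" "\<forall>k\<le>n. largest_zero \<phi>p \<noteq> ereal (- real k)"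
    using assms M_pole_iff by blast
  have a: "abscissa \<phi>p < ereal (- real n)" using z n by (simp add: in_vstrip_iff)
  then have "Gamma_cofactor (- of_nat n) \<noteq> 0" using n by (simp add: Gamma_cofactor_minus_nat_eq_0_iff)
  then show ?thesis using M_at_minus_nat(3)[OF a] n by simp
qed

lemma M_simple_poles_on:
  assumes "{z \<in> vstrip (abscissa \<phi>p) (1 - abar \<phi>m). is_pole M z} = P"
  shows "simple_poles_on M (vstrip (abscissa \<phi>p) (1 - abar \<phi>m)) P"
  using assms M_simple_pole by (auto simp: simple_poles_on_def)

lemma M_poles_generic:
  assumes "largest_zero \<phi>p = - \<infinity> \<or> (\<nexists>m::nat. - largest_zero \<phi>p = ereal (real m))"
  shows "simple_poles_on M (vstrip (abscissa \<phi>p) (1 - abar \<phi>m))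
           {- of_nat n |n::nat. abscissa \<phi>p < ereal (- real n)}"
proof (rule M_simple_poles_on)
  have "largest_zero \<phi>p \<noteq> ereal (- real k)" for k
  proof
    assume "largest_zero \<phi>p = ereal (- real k)"
    then have "- largest_zero \<phi>p = ereal (real k)" "largest_zero \<phi>p \<noteq> - \<infinity>" by simp_all
    with assms show False by blast
  qed
  then show "{z \<in> vstrip (abscissa \<phi>p) (1 - abar \<phi>m). is_pole M z}
      = {- of_nat n |n::nat. abscissa \<phi>p < ereal (- real n)}"
    using M_pole_iff minus_nat_in_strip_iff by blast
qed

text \<open>The zero of \<open>\<phi>p\<close> may sit exactly at the abscissa; then the points \<open>- n\<close> with \<open>n \<ge> m\<close> lie outside
  the strip instead of being cancelled.\<close>

lemma M_poles_finite:
  assumes "- largest_zero \<phi>p = ereal (real m)"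
  shows "simple_poles_on M (vstrip (abscissa \<phi>p) (1 - abar \<phi>m)) {- of_nat n |n::nat. n \<notin> {m..}}"
proof (rule M_simple_poles_on)
  have lz: "largest_zero \<phi>p = ereal (- real m)"
    using assms by (cases "largest_zero \<phi>p") auto
  have iff: "(\<forall>k\<le>n. largest_zero \<phi>p \<noteq> ereal (- real k)) \<longleftrightarrow> n < m" for n
    by (cases "n < m") (auto simp: lz)
  have "abscissa \<phi>p \<le> ereal (- real m)"
    using p.largest_zero_in_zero_limits[OF lz] by (simp add: p.zero_limits_def)
  then have strip: "- of_nat n \<in> vstrip (abscissa \<phi>p) (1 - abar \<phi>m)" if "n < m" for n
    unfolding minus_nat_in_strip_iff by (rule le_less_trans) (use that in simp)
  show "{z \<in> vstrip (abscissa \<phi>p) (1 - abar \<phi>m). is_pole M z} = {- of_nat n |n::nat. n \<notin> {m..}}"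
  proof (intro equalityI subsetI)
    fix z assume "z \<in> {z \<in> vstrip (abscissa \<phi>p) (1 - abar \<phi>m). is_pole M z}"
    then obtain n where "z = - of_nat n" "n < m" using M_pole_iff iff by blast
    then show "z \<in> {- of_nat n |n::nat. n \<notin> {m..}}" by auto
  next
    fix z :: complex assume "z \<in> {- of_nat n |n::nat. n \<notin> {m..}}"
    then obtain n where n: "z = - of_nat n" "n < m" by (auto simp: not_le)
    then show "z \<in> {z \<in> vstrip (abscissa \<phi>p) (1 - abar \<phi>m). is_pole M z}"
      using M_pole_iff[of z] iff strip by blast
  qed
qed

lemma M_residue:
  assumes "- of_nat n \<in> vstrip (abscissa \<phi>p) (1 - abar \<phi>m)"
  shows "residue M (- of_nat n) = \<phi>p 0 * (\<Prod>k=1..n. Psi_ext \<phi>p \<phi>m (of_nat k)) / fact n"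
proof -
  have a: "abscissa \<phi>p < ereal (- real n)" using assms by (simp only: minus_nat_in_strip_iff)
  have "(\<Prod>k=1..n. Psi_ext \<phi>p \<phi>m (of_nat k))
      = (\<Prod>k=1..n. (- 1) * (bext \<phi>p (- of_nat k) * \<phi>m (of_nat k)))"
    by (intro prod.cong refl) (simp add: Psi_ext_def m.bext_eq_\<phi>)
  also have "\<dots> = (- 1) ^ n * ((\<Prod>k=1..n. bext \<phi>p (- of_nat k)) * (\<Prod>k=1..n. \<phi>m (of_nat k)))"
    by (simp only: prod.distrib prod_constant card_atLeastAtMost) simp
  finally have 1: "(\<Prod>k=1..n. Psi_ext \<phi>p \<phi>m (of_nat k)) = \<dots>" .
  have 2: "(\<Prod>k\<le>n. bext \<phi>p (- of_nat k)) = \<phi>p 0 * (\<Prod>k=1..n. bext \<phi>p (- of_nat k))"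
    by (simp add: atMost_atLeast0 prod.atLeast_Suc_atMost p.bext_eq_\<phi>)
  show ?thesis
    unfolding M_at_minus_nat(1)[OF a] Gamma_cofactor_minus_nat[OF a] 1 2 by simp
qed

section \<open>Independence of the choice of the factors\<close>

text \<open>\<open>W\<^sub>+\<close> is multiplied by \<open>c\<^sup>z\<^sup>-\<^sup>1\<close> and \<open>W\<^sub>-(1 - z)\<close> by \<open>c\<^sup>z\<close>.\<close>

lemma M_scale:
  assumes c: "0 < c" and z: "z \<in> strip"
  shows "M_Psi (\<lambda>w. of_real c * \<phi>p w) (\<lambda>w. of_real (inverse c) * \<phi>m w) z = of_real c * M z"
proof -
  let ?p = "\<lambda>w. of_real c * \<phi>p w" and ?m = "\<lambda>w. of_real (inverse c) * \<phi>m w"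
  have abs: "abscissa ?p = abscissa \<phi>p" "abscissa ?m = abscissa \<phi>m"
    using c by (intro abscissa_scale; simp)+
  have raw: "M_raw ?p ?m w = of_real c * M_raw \<phi>p \<phi>m w" if "w \<in> strip" for w
  proof -
    have "bg_W ?p w = exp (of_real (ln c) * (w - 1)) * bg_W \<phi>p w"
      using that by (intro p.bg_W_scale c) (simp add: in_vstrip_iff)
    moreover have "bg_W ?m (1 - w) = exp (of_real (ln (inverse c)) * (1 - w - 1)) * bg_W \<phi>m (1 - w)"
      using that c by (intro m.bg_W_scale) (simp_all add: in_vstrip_iff)
    moreover have "exp (of_real (ln (inverse c)) * (1 - w - 1))
        = of_real c * exp (of_real (ln c) * (w - 1))"
    proof -
      have "exp (of_real (ln (inverse c)) * (1 - w - 1))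
          = exp (of_real (ln c)) * exp (of_real (ln c) * (w - 1))"
        using c by (simp add: ln_inverse algebra_simps flip: exp_add)
      then show ?thesis using c by (simp add: exp_of_real)
    qed
    ultimately show ?thesis by (simp add: M_raw_def)
  qed
  have "\<forall>\<^sub>F w in at z. M_raw ?p ?m w = of_real c * M_raw \<phi>p \<phi>m w"
    using eventually_at_in_open'[OF open_vstrip z] by eventually_elim (rule raw)
  then have "remove_sings (M_raw ?p ?m) z = remove_sings (\<lambda>w. of_real c * M_raw \<phi>p \<phi>m w) z"
    by (rule remove_sings_cong) simp
  also have "\<dots> = of_real c * remove_sings (M_raw \<phi>p \<phi>m) z"
    using c z M_raw_meromorphic
    by (intro remove_sings_cmult meromorphic_on_not_essential) (auto intro: meromorphic_on_subset)
  finally show ?thesis unfolding M_Psi_def abs by (simp only: z if_True)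
qed

end

section \<open>The recurrence, regularity and poles of M\<close>

theorem theorem2p1:
  fixes \<Psi> \<phi>p \<phi>m :: "complex \<Rightarrow> complex"
  assumes "\<Psi> \<in> N_bar"
    and "wiener_hopf \<Psi> \<phi>p \<phi>m"
  shows
    "(\<forall>z \<in> iR - (Z0 \<Psi> \<union> {0}). M_Psi \<phi>p \<phi>m (z + 1) = - z / \<Psi> (- z) * M_Psi \<phi>p \<phi>m z)
   \<and> a_Psi \<phi>p \<le> 0
   \<and> M_Psi \<phi>p \<phi>m holomorphic_on vstrip (a_Psi \<phi>p) (1 - abar \<phi>m)
   \<and> (a_Psi \<phi>p = 0 \<longrightarrow>
        (if deriv_at_0_infinite \<phi>p \<or> abar \<phi>p < 0 \<or> \<phi>p 0 \<noteq> 0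
         then extends_continuously (M_Psi \<phi>p \<phi>m) (vstrip 0 (1 - abar \<phi>m)) (iR - {0})
         else M_Psi \<phi>p \<phi>m \<in> hol_left_closed 0 (1 - abar \<phi>m)))
   \<and> M_Psi \<phi>p \<phi>m meromorphic_on vstrip (abscissa \<phi>p) (1 - abscissa \<phi>m)
   \<and> (abscissa \<phi>p \<le> abar \<phi>p \<and> abar \<phi>p < 0 \<longrightarrow>
        (largest_zero \<phi>p = - \<infinity> \<or> (\<nexists>m::nat. - largest_zero \<phi>p = ereal (real m)) \<longrightarrow>
           simple_poles_on (M_Psi \<phi>p \<phi>m) (vstrip (abscissa \<phi>p) (1 - abar \<phi>m))
             {- of_nat n |n::nat. abscissa \<phi>p < ereal (- real n)})
      \<and> (\<forall>m::nat. - largest_zero \<phi>p = ereal (real m) \<longrightarrow>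
           simple_poles_on (M_Psi \<phi>p \<phi>m) (vstrip (abscissa \<phi>p) (1 - abar \<phi>m))
             {- of_nat n |n::nat. n \<notin> {m..}})
      \<and> (\<forall>n::nat. - of_nat n \<in> vstrip (abscissa \<phi>p) (1 - abar \<phi>m)
             \<and> is_pole (M_Psi \<phi>p \<phi>m) (- of_nat n) \<longrightarrow>
           residue (M_Psi \<phi>p \<phi>m) (- of_nat n)
             = \<phi>p 0 * (\<Prod>k=1..n. Psi_ext \<phi>p \<phi>m (of_nat k)) / fact n))
   \<and> (\<forall>c::real. c > 0 \<longrightarrow>
        (\<exists>K::complex. K \<noteq> 0 \<and>
           (\<forall>z \<in> vstrip (abscissa \<phi>p) (1 - abscissa \<phi>m).
              M_Psi (\<lambda>w. of_real c * \<phi>p w) (\<lambda>w. of_real (inverse c) * \<phi>m w) z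
                = K * M_Psi \<phi>p \<phi>m z)))"
proof -
  have wh: "\<phi>p \<in> bernstein" "\<phi>m \<in> bernstein" "\<And>z. z \<in> iR \<Longrightarrow> \<Psi> z = - \<phi>p (- z) * \<phi>m z"
    using assms(2) by (auto simp: wiener_hopf_def)
  obtain qp dp \<mu>p where p: "bernstein_rep \<phi>p qp dp \<mu>p" by (rule bernstein_imp_rep[OF wh(1)])
  obtain qm dm \<mu>m where m: "bernstein_rep \<phi>m qm dm \<mu>m" by (rule bernstein_imp_rep[OF wh(2)])
  interpret bernstein_pair \<phi>p qp dp \<mu>p \<phi>m qm dm \<mu>m
    using p m by (rule bernstein_pair.intro)
  have recurrence: "M (z + 1) = - z / \<Psi> (- z) * M z" if z: "z \<in> iR - (Z0 \<Psi> \<union> {0})" for z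
  proof -
    have "\<Psi> (- z) = - (\<phi>p z * \<phi>m (- z))" "\<Psi> (- z) \<noteq> 0" "Re z = 0" "z \<noteq> 0"
      using z wh(3)[of "- z"] by (auto simp: Z0_def vline_def zero_ereal_def)
    then show ?thesis using M_recurrence[of z] by simp
  qed
  have boundary: "if deriv_at_0_infinite \<phi>p \<or> abar \<phi>p < 0 \<or> \<phi>p 0 \<noteq> 0
         then extends_continuously M (vstrip 0 (1 - abar \<phi>m)) (iR - {0})
         else M \<in> hol_left_closed 0 (1 - abar \<phi>m)" if "a_Psi \<phi>p = 0"
    using M_extends_off_0 M_extends_to_line M_holomorphic that by (auto simp: hol_left_closed_def)
  have scaling: "\<exists>K::complex. K \<noteq> 0 \<and> (\<forall>z \<in> strip.
      M_Psi (\<lambda>w. of_real c * \<phi>p w) (\<lambda>w. of_real (inverse c) * \<phi>m w) z = K * M z)"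
    if "c > 0" for c :: real
    using that M_scale by (intro exI[of _ "of_real c"]) auto
  show ?thesis
    by (intro conjI impI allI ballI recurrence a_Psi_le_0 M_holomorphic boundary M_meromorphic
        M_poles_generic M_poles_finite M_residue scaling; (elim conjE)?; assumption?)
qed

end
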